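(* Let $P_7(r)$ denote the perimeter of the combinatorial disk $D_7(r)$ of radius $r$ in the complex $X_7$ (centered at any vertex $v$ of $X_7$), and let $F_n$ denote the $n$-th Fibonacci number. Then for every integer $r\ge 1$, $$P_7(r) = 7F_{2r}.$$
   Context: $X_7$ is the simply connected triangulated surface (without boundary) obtained by gluing together equilateral triangles with side length $1$ along their edges so that there are exactly $7$ triangles at every vertex. Combinatorially, it is the tiling of the hyperbolic plane by equilateral triangles with all angles $2\pi/7$, seven around each vertex. Fix any vertex $v$ of $X_7$. The combinatorial disk $D_7(r)$ of radius $r$ is the subcomplex defined iteratively by: $D_7(0)=\{v\}$, and $D_7(r+1)$ is the union of $D_7(r)$ and all (closed) triangles of $X_7$ that share a vertex with $D_7(r)$. The perimeter $P_7(r)$ is the number of edges (each of length $1$) in the boundary $\partial D_7(r)$, i.e. the number of edges of $X_7$ that lie in exactly one triangle of $D_7(r)$. Fibonacci numbers: $F_0=0$, $F_1=1$, $F_{n+1}=F_n+F_{n-1}$. *)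

theory Defs
  imports "HOL-Analysis.Analysis" "HOL-Number_Theory.Fib"
begin

definition abstract_complex :: "'v set set \<Rightarrow> bool" where
  "abstract_complex K \<longleftrightarrow>
     (\<forall>s\<in>K. finite s \<and> s \<noteq> {} \<and> (\<forall>t. t \<subseteq> s \<and> t \<noteq> {} \<longrightarrow> t \<in> K))"

definition vertices :: "'v set set \<Rightarrow> 'v set" where
  "vertices K = \<Union>K"

definition edges :: "'v set set \<Rightarrow> 'v set set" where
  "edges K = {s \<in> K. card s = 2}"

definition triangles :: "'v set set \<Rightarrow> 'v set set" where
  "triangles K = {s \<in> K. card s = 3}"

definition vertex_link :: "'v set set \<Rightarrow> 'v \<Rightarrow> 'v set set" where
  "vertex_link K v = {s \<in> K. v \<notin> s \<and> insert v s \<in> K}"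

definition is_circle :: "'v set set \<Rightarrow> bool" where
  "is_circle C \<longleftrightarrow>
     (\<exists>xs. distinct xs \<and> 3 \<le> length xs \<and>
        C = {{xs ! i} |i. i < length xs} \<union>
            {{xs ! i, xs ! (Suc i mod length xs)} |i. i < length xs})"

(* A surface without boundary: every vertex link is a circle.  In particular the complex is
   purely two-dimensional, every edge lies in exactly two triangles, and only finitely many
   triangles meet at each vertex. *)
definition triangulated_surface :: "'v set set \<Rightarrow> bool" where
  "triangulated_surface K \<longleftrightarrow>
     abstract_complex K \<and> (\<forall>v\<in>vertices K. is_circle (vertex_link K v))"

(* Points are given by their barycentric coordinates.  The ambient type carries the product
   topology; for a locally finite complex the topology it induces on the realization is the
   usual (weak) one. *)
definition geometric_realization :: "'v set set \<Rightarrow> ('v \<Rightarrow> real) set" where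
  "geometric_realization K =
     {f. \<exists>s\<in>K. (\<forall>x. 0 \<le> f x) \<and> (\<forall>x. x \<notin> s \<longrightarrow> f x = 0) \<and> (\<Sum>x\<in>s. f x) = 1}"

(* These conditions determine K up to isomorphism, so X7 K says that K is (a labelled
   copy of) the complex X_7. *)
definition X7 :: "'v set set \<Rightarrow> bool" where
  "X7 K \<longleftrightarrow>
     triangulated_surface K \<and> K \<noteq> {} \<and>
     simply_connected (geometric_realization K) \<and>
     (\<forall>v\<in>vertices K. card {t \<in> triangles K. v \<in> t} = 7)"

primrec comb_disk :: "'v set set \<Rightarrow> 'v \<Rightarrow> nat \<Rightarrow> 'v set set" where
  "comb_disk K v 0 = {{v}}"
| "comb_disk K v (Suc r) =
     comb_disk K v r \<union>
     {s. s \<noteq> {} \<and> (\<exists>t\<in>triangles K. t \<inter> vertices (comb_disk K v r) \<noteq> {} \<and> s \<subseteq> t)}"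

definition boundary_edges :: "'v set set \<Rightarrow> 'v set set \<Rightarrow> 'v set set" where
  "boundary_edges K D = {e \<in> edges K. card {t \<in> triangles D. e \<subseteq> t} = 1}"

definition perimeter :: "'v set set \<Rightarrow> 'v \<Rightarrow> nat \<Rightarrow> nat" where
  "perimeter K v r = card (boundary_edges K (comb_disk K v r))"

end

theory Submission
  imports Defs
begin

text \<open>The tiling has an explicit layered model in which each vertex is joined to its parent(s) one layer
  further in, to two vertices of its own layer and to two or three new vertices further out. A vertex
  link in \<open>K\<close> being a heptagon, the model develops into \<open>K\<close> layer by layer, and the resulting map is a
  simplicial covering. A null homotopy of a loop, subdivided finely enough for each small square to go
  into an open vertex star, shows that lifted loops close; hence the covering is injective, and \<open>K\<close> is
  the model. There the boundary of the disk of radius \<open>r\<close> is the cycle formed by layer \<open>r\<close>. If \<open>a\<^sub>r\<close> is the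
  length of this cycle, then \<open>a\<^sub>r\<^sub>+\<^sub>2 = 3 a\<^sub>r\<^sub>+\<^sub>1 - a\<^sub>r\<close>, which is the recurrence of the
  Fibonacci numbers of even index.\<close>

section \<open>Monodromy of simplicial coverings\<close>

text \<open>The local conditions alone do not give the formula: a closed surface with seven
  triangles at every vertex satisfies them, and its disks stop growing. Simple connectivity of the
  realization has to enter, although everything counted is combinatorial. No covering of topological
  spaces is built for this. The bridge is that vertices with positive coordinates at one point of
  the realization span a simplex: a labelled grid over a homotopy becomes a family of simplices, on
  which only lifts of vertices to adjacent vertices are needed. The set where a given coordinate is
  positive is open in the product topology, as the Lebesgue number argument requires.
  \<open>K\<close> also comes without an orientation. One is chosen at the centre by listing its
  link in order, and it spreads outwards because each further link is listed starting from two
  neighbours that are already developed.\<close>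

lemma positive_set_simplex:
  assumes "abstract_complex K" "f \<in> geometric_realization K" "A \<noteq> {}" "\<And>a. a \<in> A \<Longrightarrow> 0 < f a"
  shows "A \<in> K"
proof -
  obtain s where s: "s \<in> K" "\<And>x. x \<notin> s \<Longrightarrow> f x = 0"
    using assms(2) unfolding geometric_realization_def by blast
  have "A \<subseteq> s"
    using s(2) assms(4) by force
  then show ?thesis
    using assms(1,3) s(1) unfolding abstract_complex_def by blast
qed

lemma realization_has_positive:
  assumes "f \<in> geometric_realization K"
  obtains x where "0 < f x"
proof -
  obtain s where s: "\<forall>x. 0 \<le> f x" "(\<Sum>x\<in>s. f x) = 1"
    using assms unfolding geometric_realization_def by blast
  have "\<exists>x\<in>s. f x \<noteq> 0"
    by (rule ccontr) (use s(2) in simp)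
  then show thesis
    using that s(1) by (metis less_eq_real_def)
qed

lemma open_vertex_star: "open {f :: 'v \<Rightarrow> real. 0 < f x}"
proof -
  have "continuous_on UNIV (\<lambda>f :: 'v \<Rightarrow> real. f x)"
    by simp
  then show ?thesis
    by (intro open_Collect_less) auto
qed

lemma segment_in_realization:
  assumes "abstract_complex K" "{a, b} \<in> K" "0 \<le> s" "s \<le> 1"
  shows "(\<lambda>x. (1 - s) * indicator {a} x + s * indicator {b} x) \<in> geometric_realization K"
proof (cases "a = b")
  case True
  have "(\<lambda>x. (1 - s) * indicator {a} x + s * indicator {b} x) = (indicator {a} :: 'a \<Rightarrow> real)"
    using True by (auto simp: indicator_def)
  then show ?thesis
    using assms True unfolding geometric_realization_def
    by (auto intro!: bexI[of _ "{a}"] simp: indicator_def)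
next
  case False
  then show ?thesis
    using assms unfolding geometric_realization_def
    by (auto intro!: bexI[of _ "{a, b}"] simp: indicator_def)
qed

lemma vertex_in_realization:
  assumes "abstract_complex K" "{a} \<in> K"
  shows "(indicator {a} :: 'a \<Rightarrow> real) \<in> geometric_realization K"
  using assms unfolding geometric_realization_def by (auto intro!: bexI[of _ "{a}"] simp: indicator_def)

lemma abstract_complex_face:
  assumes "abstract_complex K" "s \<in> K" "t \<subseteq> s" "t \<noteq> {}"
  shows "t \<in> K"
proof -
  have "\<forall>t. t \<subseteq> s \<and> t \<noteq> {} \<longrightarrow> t \<in> K"
    using bspec[OF assms(1)[unfolded abstract_complex_def] assms(2)] by (elim conjE)
  then show ?thesis
    using assms(3,4) by (elim allE[of _ t]) (rule mp, assumption, rule conjI)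
qed

lemma vertex_simplex:
  assumes "abstract_complex K" "a \<in> vertices K"
  shows "{a} \<in> K"
proof -
  obtain s where "s \<in> K" "a \<in> s"
    using assms(2) unfolding vertices_def by (elim UnionE)
  then show ?thesis
    by (simp add: abstract_complex_face[OF assms(1), of s])
qed

lemma simply_connected_loops_homotopic:
  assumes "simply_connected S" "continuous_on {0..1} p" "p 1 = p 0" "p ` {0..1} \<subseteq> S" "c \<in> S"
  shows "homotopic_loops S p (\<lambda>_. c)"
proof -
  have "path (\<lambda>_::real. c)" "path_image (\<lambda>_::real. c) \<subseteq> S"
    using assms(5) by (simp_all add: path_def path_image_def)
  then show ?thesis
    using assms unfolding simply_connected_def path_def path_image_def pathstart_def pathfinish_def
    by blast
qed

text \<open>Simple connectivity makes constant loops at two vertices homotopic, and the track of one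
  point under the homotopy is a path between them. The open stars of vertices inside and outside
  \<open>A\<close> would disconnect this path, since a point in both kinds of star yields an edge
  leaving \<open>A\<close>.\<close>

lemma simply_connected_adjacency_closed:
  fixes K :: "'v set set"
  assumes K: "abstract_complex K" and sc: "simply_connected (geometric_realization K)"
    and A: "a \<in> A" "a \<in> vertices K" "\<And>x y. x \<in> A \<Longrightarrow> {x, y} \<in> K \<Longrightarrow> y \<in> A"
    and b: "b \<in> vertices K"
  shows "b \<in> A"
proof (rule ccontr)
  assume "b \<notin> A"
  let ?S = "geometric_realization K"
  let ?d = "\<lambda>c::'v. (indicator {c} :: 'v \<Rightarrow> real)"
  have d: "?d a \<in> ?S" "?d b \<in> ?S"
    by (rule vertex_in_realization[OF K vertex_simplex[OF K]]; fact)+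
  have "homotopic_loops ?S (\<lambda>_. ?d a) (\<lambda>_. ?d b)"
    by (rule simply_connected_loops_homotopic[OF sc continuous_on_const refl _ d(2)]) (use d(1) in blast)
  then obtain h where h: "continuous_on ({0..1::real} \<times> {0..1::real}) h"
      "h \<in> {0..1} \<times> {0..1} \<rightarrow> ?S" "\<And>t. t \<in> {0..1} \<Longrightarrow> h (0, t) = ?d a" "\<And>t. t \<in> {0..1} \<Longrightarrow> h (1, t) = ?d b"
    unfolding homotopic_loops by auto
  define g where "g t = h (t, 0)" for t
  have g: "continuous_on {0..1} g"
    unfolding g_def by (rule continuous_on_compose2[OF h(1)]) (auto intro!: continuous_intros)
  have gS: "g t \<in> ?S" if "t \<in> {0..1}" for t
    using that h(2) unfolding g_def by auto
  define U where "U = (\<Union>x\<in>A. {f :: 'v \<Rightarrow> real. 0 < f x})"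
  define W where "W = (\<Union>x\<in>-A. {f :: 'v \<Rightarrow> real. 0 < f x})"
  have op: "open U" "open W"
    unfolding U_def W_def by (auto intro: open_vertex_star)
  have disj: "U \<inter> W \<inter> ?S = {}"
  proof (rule ccontr)
    assume "U \<inter> W \<inter> ?S \<noteq> {}"
    then obtain f x y where f: "f \<in> ?S" "x \<in> A" "y \<notin> A" "0 < f x" "0 < f y"
      unfolding U_def W_def by auto
    have "{x, y} \<in> K"
      by (rule positive_set_simplex[OF K f(1)]) (use f in auto)
    then show False
      using A(3) f by blast
  qed
  have cov: "?S \<subseteq> U \<union> W"
  proof
    fix f assume "f \<in> ?S"
    then obtain x where "0 < f x"
      using realization_has_positive by blast
    then show "f \<in> U \<union> W"
      unfolding U_def W_def by auto
  qed
  have "connected (g ` {0..1})"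
    using g by (intro connected_continuous_image) auto
  moreover have "?d a \<in> g ` {0..1}" "?d b \<in> g ` {0..1}"
    using h(3)[of 0] h(4)[of 0] unfolding g_def by (auto simp: image_iff intro: bexI[of _ 0] bexI[of _ 1])
  moreover have "?d a \<in> U" "?d b \<in> W"
    using A(1) \<open>b \<notin> A\<close> unfolding U_def W_def by (auto intro: bexI[of _ a] bexI[of _ b])
  moreover have "g ` {0..1} \<subseteq> ?S"
    using gS by blast
  ultimately show False
    using op disj cov unfolding connected_def by blast
qed

text \<open>\<open>L p w\<close> is the lift at the sheet of \<open>p\<close> of a vertex \<open>w\<close> equal or adjacent to \<open>\<phi> p\<close>; off those \<open>w\<close>
  nothing is assumed.\<close>

locale simplicial_covering =
  fixes K :: "'v set set" and V :: "'m set" and \<phi> :: "'m \<Rightarrow> 'v" and L :: "'m \<Rightarrow> 'v \<Rightarrow> 'm"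
  assumes complex: "abstract_complex K"
    and lift_in: "\<And>p w. p \<in> V \<Longrightarrow> {\<phi> p, w} \<in> K \<Longrightarrow> L p w \<in> V"
    and lift_over: "\<And>p w. p \<in> V \<Longrightarrow> {\<phi> p, w} \<in> K \<Longrightarrow> \<phi> (L p w) = w"
    and lift_self: "\<And>p. p \<in> V \<Longrightarrow> L p (\<phi> p) = p"
    and lift_lift: "\<And>p w u. p \<in> V \<Longrightarrow> {\<phi> p, w, u} \<in> K \<Longrightarrow> L (L p w) u = L p u"
begin

lemmas face = abstract_complex_face[OF complex]

primrec lift_walk :: "(nat \<Rightarrow> 'v) \<Rightarrow> 'm \<Rightarrow> nat \<Rightarrow> 'm" where
  "lift_walk a p 0 = p"
| "lift_walk a p (Suc j) = L (lift_walk a p j) (a (Suc j))"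

text \<open>All sheets over \<open>a 0\<close> are included because passing to a neighbouring loop
  along a rung changes the starting sheet together with the starting vertex.\<close>

definition closes :: "nat \<Rightarrow> (nat \<Rightarrow> 'v) \<Rightarrow> bool" where
  "closes n a \<longleftrightarrow> (\<forall>p\<in>V. \<phi> p = a 0 \<longrightarrow> lift_walk a p n = p)"

lemma lift_walk_over:
  assumes "\<And>j. j < n \<Longrightarrow> {a j, a (Suc j)} \<in> K" "p \<in> V" "\<phi> p = a 0" "j \<le> n"
  shows "lift_walk a p j \<in> V \<and> \<phi> (lift_walk a p j) = a j"
  using assms(4)
proof (induction j)
  case (Suc j)
  then show ?case
    using assms(1)[of j] lift_in lift_over by auto
qed (use assms in simp)

text \<open>The rungs of the ladder lift as well, and lifting along a rung is injective.\<close>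

lemma closes_ladder:
  assumes sq: "\<And>j. j < n \<Longrightarrow> {a j, a (Suc j), b j, b (Suc j)} \<in> K"
    and n: "0 < n" and a: "a n = a 0" and b: "b n = b 0" and cl: "closes n b"
  shows "closes n a"
  unfolding closes_def
proof (intro ballI impI)
  fix p assume p: "p \<in> V" "\<phi> p = a 0"
  have edge: "{a j, a (Suc j)} \<in> K" if "j < n" for j
    using sq[OF that] by (rule face) auto
  note P = lift_walk_over[OF edge p]
  have lad: "lift_walk b (L p (b 0)) j = L (lift_walk a p j) (b j)" if "j \<le> n" for j
    using that
  proof (induction j)
    case (Suc j)
    define P where "P = lift_walk a p j"
    have P: "P \<in> V" "\<phi> P = a j"
      using P[of j] Suc.prems unfolding P_def by auto
    \<comment> \<open>The diagonal from \<open>a j\<close> to \<open>b (Suc j)\<close> cuts the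
      square into two triangles; by \<open>lift_lift\<close> both routes round the square end at the
      lift along this diagonal.\<close>
    have "{\<phi> P, b j, b (Suc j)} \<in> K" "{\<phi> P, a (Suc j), b (Suc j)} \<in> K"
      using sq[of j] Suc.prems P by (auto elim: face)
    then show ?case
      using Suc lift_lift[OF P(1)] by (simp add: P_def)
  qed simp
  have p0: "{a 0, b 0} \<in> K"
    using sq[OF n] by (rule face) auto
  define q where "q = L p (b 0)"
  define p' where "p' = lift_walk a p n"
  have p': "p' \<in> V" "\<phi> p' = a 0"
    using P[of n] a unfolding p'_def by auto
  have q: "q \<in> V" "\<phi> q = b 0"
    using p0 p lift_in lift_over unfolding q_def by auto
  have "q = lift_walk b q n"
    using cl q unfolding closes_def by simp
  also have "\<dots> = L p' (b 0)"
    using lad[of n] b unfolding q_def p'_def by simp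
  finally have "L (L p (b 0)) (a 0) = L (L p' (b 0)) (a 0)"
    unfolding q_def by simp
  moreover have "L (L r (b 0)) (a 0) = r" if "r \<in> V" "\<phi> r = a 0" for r
    using lift_lift[of r "b 0" "a 0"] lift_self[of r] that p0 by (simp add: insert_commute)
  ultimately show "lift_walk a p n = p"
    using p p' unfolding p'_def by simp
qed

lemma closes_constant: "closes n (\<lambda>_. w)"
proof -
  have "lift_walk (\<lambda>_. w) p n = p" if "p \<in> V" "\<phi> p = w" for p
    using that by (induction n) (auto simp: lift_self)
  then show ?thesis
    unfolding closes_def by auto
qed

text \<open>The loop forms a ladder with the constant loop at \<open>a 0\<close>, all of whose
  squares lie in \<open>s\<close>.\<close>

lemma closes_in_simplex:
  assumes "\<And>j. j \<le> n \<Longrightarrow> a j \<in> s" "s \<in> K" "0 < n" "a n = a 0"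
  shows "closes n a"
proof (rule closes_ladder[OF _ assms(3,4) refl closes_constant[of n "a 0"]])
  fix j assume "j < n"
  then have "{a j, a (Suc j), a 0, a 0} \<subseteq> s"
    using assms(1)[of j] assms(1)[of "Suc j"] assms(1)[of 0] by auto
  then show "{a j, a (Suc j), a 0, a 0} \<in> K"
    using assms(2) face by blast
qed

text \<open>Row \<open>i\<close> of labels is compared with row \<open>i + 1\<close>; four squares meeting at a grid point carry labels in
  the support of the image of that point. The loops are only freely homotopic, which is why the rows
  are cyclic rather than pinned at their ends.\<close>

lemma closes_grid:
  assumes N: "0 < N"
    and g: "\<And>i j. i \<le> N \<Longrightarrow> j \<le> N \<Longrightarrow> g i j \<in> geometric_realization K"
    and lab: "\<And>i j i' j'. i < N \<Longrightarrow> j < N \<Longrightarrow> i' \<in> {i, Suc i} \<Longrightarrow> j' \<in> {j, Suc j} \<Longrightarrow> 0 < g i' j' (\<sigma> i j)"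
    and const: "\<And>j. j \<le> N \<Longrightarrow> g N j = c"
    and per: "\<And>i. i \<le> N \<Longrightarrow> g i N = g i 0"
  shows "closes N (\<lambda>j. \<sigma> 0 (j mod N))"
proof -
  \<comment> \<open>Column \<open>N\<close> of the labels is read as column 0; periodicity of
    \<open>g\<close> keeps the labels positive there.\<close>
  have pos: "0 < g i' j' (\<sigma> i (j mod N))"
    if "i < N" "j \<le> N" "i' \<in> {i, Suc i}" "j' \<le> N" "j' = j \<or> j < N \<and> j' = Suc j" for i j i' j'
  proof (cases "j = N")
    case True
    then show ?thesis
      using that lab[of i 0 i' 0] N per[of i'] by auto
  next
    case False
    then show ?thesis
      using that lab[of i j i' j'] by auto
  qed
  \<comment> \<open>The induction runs backwards from row \<open>N - 1\<close>. The labels of that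
    row are all positive at the single point \<open>c\<close>, so they lie in one simplex.\<close>
  have "closes N (\<lambda>j. \<sigma> (N - Suc i) (j mod N))" if "i < N" for i
    using that
  proof (induction i)
    case 0
    have c: "c \<in> geometric_realization K"
      using g[of N 0] const[of 0] by simp
    have "0 < c (\<sigma> (N - 1) (j mod N))" if "j \<le> N" for j
      using pos[of "N - 1" j N j] const[of j] that N by auto
    then have "(\<lambda>j. \<sigma> (N - 1) (j mod N)) ` {..N} \<in> K"
      by (intro positive_set_simplex[OF complex c]) auto
    then show ?case
      by (intro closes_in_simplex[where s = "(\<lambda>j. \<sigma> (N - 1) (j mod N)) ` {..N}"]) (use N in auto)
  next
    case (Suc i)
    define k where "k = N - Suc (Suc i)"
    have k: "N - Suc i = Suc k" "Suc k < N"
      using Suc.prems unfolding k_def by auto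
    have "closes N (\<lambda>j. \<sigma> k (j mod N))"
    proof (rule closes_ladder[where b = "\<lambda>j. \<sigma> (Suc k) (j mod N)"])
      fix j assume j: "j < N"
      show "{\<sigma> k (j mod N), \<sigma> k (Suc j mod N), \<sigma> (Suc k) (j mod N), \<sigma> (Suc k) (Suc j mod N)} \<in> K"
        by (rule positive_set_simplex[OF complex g[of "Suc k" "Suc j"]])
          (use j k pos[of k j "Suc k" "Suc j"] pos[of k "Suc j" "Suc k" "Suc j"]
            pos[of "Suc k" j "Suc k" "Suc j"] pos[of "Suc k" "Suc j" "Suc k" "Suc j"] in auto)
    qed (use N Suc k in auto)
    then show ?case
      unfolding k_def .
  qed
  from this[of "N - 1"] show ?thesis
    using N by simp
qed

end

text \<open>A sum of hat functions: at time \<open>m / n\<close> the polygon is at the vertex \<open>w m\<close>.\<close>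

definition polygon :: "(nat \<Rightarrow> 'v) \<Rightarrow> nat \<Rightarrow> real \<Rightarrow> 'v \<Rightarrow> real" where
  "polygon w n t = (\<lambda>x. \<Sum>m\<le>n. max 0 (1 - \<bar>real n * t - real m\<bar>) * indicator {w m} x)"

lemma polygon_segment:
  assumes "m < n" "real m \<le> real n * t" "real n * t \<le> real (Suc m)"
  shows "polygon w n t =
    (\<lambda>x. (1 - (real n * t - real m)) * indicator {w m} x + (real n * t - real m) * indicator {w (Suc m)} x)"
proof
  fix x
  let ?F = "\<lambda>i. max 0 (1 - \<bar>real n * t - real i\<bar>) * (indicator {w i} x :: real)"
  have "sum ?F {..n} = sum ?F {m, Suc m}"
  proof (rule sum.mono_neutral_right)
    show "\<forall>i\<in>{..n} - {m, Suc m}. ?F i = 0"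
    proof
      fix i assume i: "i \<in> {..n} - {m, Suc m}"
      then have "i < m \<or> Suc m < i" by auto
      then have "real i + 1 \<le> real m \<or> real m + 2 \<le> real i" by auto
      then have "1 - \<bar>real n * t - real i\<bar> \<le> 0"
        using assms(2,3) by (auto simp: abs_if)
      then show "?F i = 0"
        by simp
    qed
  qed (use assms in auto)
  also have "\<dots> = ?F m + ?F (Suc m)"
  proof -
    have "sum G {m, Suc m} = G m + G (Suc m)" for G :: "nat \<Rightarrow> real"
      by simp
    then show ?thesis .
  qed
  also have "max 0 (1 - \<bar>real n * t - real m\<bar>) = 1 - (real n * t - real m)"
    using assms by simp
  also have "max 0 (1 - \<bar>real n * t - real (Suc m)\<bar>) = real n * t - real m"
    using assms by simp
  finally show "polygon w n t x =
      (1 - (real n * t - real m)) * indicator {w m} x + (real n * t - real m) * indicator {w (Suc m)} x"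
    unfolding polygon_def .
qed

lemma polygon_position:
  assumes "0 < n" "t \<in> {0..1}"
  obtains m where "m < n" "real m \<le> real n * t" "real n * t \<le> real (Suc m)"
proof (cases "t = 1")
  case True
  then show ?thesis
    using that[of "n - 1"] assms by (auto simp: of_nat_diff)
next
  case False
  define m where "m = nat \<lfloor>real n * t\<rfloor>"
  have "0 \<le> real n * t" "real n * t < real n"
    using assms False by (auto simp: mult_less_cancel_left2)
  then have "real m \<le> real n * t" "real n * t \<le> real (Suc m)" "m < n"
    unfolding m_def by linarith+
  then show ?thesis
    using that by blast
qed

lemma continuous_on_polygon: "continuous_on S (polygon w n)"
proof (rule continuous_on_coordinatewise_then_product)
  fix x
  show "continuous_on S (\<lambda>t. polygon w n t x)"
    unfolding polygon_def
    by (intro continuous_on_sum continuous_on_mult continuous_on_max continuous_on_diff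
      continuous_on_rabs continuous_on_const continuous_on_id)
qed

section \<open>Null homotopies force lifted loops to close\<close>

context simplicial_covering
begin

text \<open>The loop \<open>w (j div k)\<close> waits at every vertex: the homotopy dictates how
  fine the grid must be, and a multiple \<open>n * k\<close> of \<open>n\<close> puts every corner
  of the polygon on a grid point.\<close>

lemma closes_polygon:
  assumes sc: "simply_connected (geometric_realization K)"
    and n: "0 < n" and w: "\<And>m. m < n \<Longrightarrow> {w m, w (Suc m)} \<in> K" and wn: "w n = w 0"
  obtains k where "0 < k" "closes (n * k) (\<lambda>j. w (j div k))"
proof -
  let ?S = "geometric_realization K"
  let ?\<gamma> = "polygon w n"
  let ?c = "indicator {w 0} :: 'v \<Rightarrow> real"
  have \<gamma>S: "?\<gamma> t \<in> ?S" if t: "t \<in> {0..1}" for t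
  proof -
    obtain m where m: "m < n" "real m \<le> real n * t" "real n * t \<le> real (Suc m)"
      using polygon_position[OF n t] by blast
    show ?thesis
      unfolding polygon_segment[OF m] by (rule segment_in_realization[OF complex w]) (use m in auto)
  qed
  have \<gamma>0: "?\<gamma> 0 = ?c"
    using polygon_segment[of 0 n 0 w] n by auto
  have \<gamma>1: "?\<gamma> 1 = ?c"
    using polygon_segment[of "n - 1" n 1 w] n wn by (auto simp: of_nat_diff)
  have c: "?c \<in> ?S"
    using \<gamma>S[of 0] \<gamma>0 by simp
  have "homotopic_loops ?S ?\<gamma> (\<lambda>_. ?c)"
    using \<gamma>S c by (intro simply_connected_loops_homotopic[OF sc] continuous_on_polygon) (auto simp: \<gamma>0 \<gamma>1)
  then obtain h where h: "continuous_on ({0..1::real} \<times> {0..1::real}) h"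
      "h \<in> {0..1} \<times> {0..1} \<rightarrow> ?S" "\<And>t. t \<in> {0..1} \<Longrightarrow> h (0, t) = ?\<gamma> t" "\<And>t. t \<in> {0..1} \<Longrightarrow> h (1, t) = ?c"
      "\<And>s. s \<in> {0..1} \<Longrightarrow> h (s, 1) = h (s, 0)"
    unfolding homotopic_loops pathfinish_def pathstart_def by (auto simp: o_def)
  let ?Q = "{0..1::real} \<times> {0..1::real}"
  have "\<exists>U. open U \<and> U \<inter> ?Q = h -` {f. 0 < f x} \<inter> ?Q" for x
    using h(1) open_vertex_star[of x] unfolding continuous_on_open_invariant by blast
  then obtain U where U: "\<And>x. open (U x)" "\<And>x. U x \<inter> ?Q = h -` {f. 0 < f x} \<inter> ?Q"
    by metis
  obtain \<delta> where \<delta>: "0 < \<delta>" "\<And>T. T \<subseteq> ?Q \<Longrightarrow> diameter T < \<delta> \<Longrightarrow> \<exists>B\<in>range U. T \<subseteq> B"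
  proof (rule Lebesgue_number_lemma[of ?Q "range U"])
    show "compact ?Q"
      by (intro compact_Times) auto
    show "?Q \<subseteq> \<Union>(range U)"
    proof
      fix z assume z: "z \<in> ?Q"
      then have "h z \<in> ?S"
        using h(2) by auto
      then obtain x where "0 < h z x"
        using realization_has_positive by blast
      then have "z \<in> U x"
        using U(2)[of x] z by blast
      then show "z \<in> \<Union>(range U)"
        by blast
    qed
  qed (use U(1) in auto)
  \<comment> \<open>A grid square has diameter at most \<open>2 / N\<close>, the sum of its two
    sides, and \<open>N = n * k\<close> is at least \<open>k\<close>.\<close>
  obtain k where k: "0 < k" "2 / real k < \<delta>"
  proof -
    obtain k where "2 / \<delta> < real k"
      using reals_Archimedean2 by blast
    then show thesis
      using that[of k] \<delta>(1) by (cases k) (auto simp: field_simps intro: le_less_trans)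
  qed
  define N where "N = n * k"
  have N: "0 < N" "k \<le> N"
    using n k unfolding N_def by auto
  define pt where "pt i = real i / real N" for i
  have pt: "pt i \<in> {0..1}" if "i \<le> N" for i
    using that N unfolding pt_def by auto
  have "\<exists>x. {pt i..pt (Suc i)} \<times> {pt j..pt (Suc j)} \<subseteq> U x" if ij: "i < N" "j < N" for i j
  proof -
    let ?T = "{pt i..pt (Suc i)} \<times> {pt j..pt (Suc j)}"
    have "{pt i..pt (Suc i)} \<subseteq> {0..1}" if "i < N" for i
      using pt[of i] pt[of "Suc i"] that by auto
    then have sub: "?T \<subseteq> ?Q"
      using ij by blast
    have "diameter ?T \<le> 2 / real N"
    proof (rule diameter_le)
      fix y z assume yz: "y \<in> ?T" "z \<in> ?T"
      have d: "\<bar>a - b\<bar> \<le> 1 / real N" if "a \<in> {pt i..pt (Suc i)}" "b \<in> {pt i..pt (Suc i)}" for a b i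
      proof -
        have "pt (Suc i) = pt i + 1 / real N"
          unfolding pt_def by (simp add: add_divide_distrib)
        then show ?thesis
          using that by auto
      qed
      have "norm (y - z) \<le> norm (fst (y - z)) + norm (snd (y - z))"
        using norm_Pair_le[of "fst u" "snd u" for u :: "real \<times> real"] by (metis prod.collapse)
      also have "\<dots> \<le> 1 / real N + 1 / real N"
        using yz d[of "fst y" i "fst z"] d[of "snd y" j "snd z"] by (intro add_mono) auto
      finally show "norm (y - z) \<le> 2 / real N"
        by simp
    qed auto
    also have "\<dots> \<le> 2 / real k"
      using N k by (intro divide_left_mono) auto
    also have "\<dots> < \<delta>"
      by (rule k)
    finally show ?thesis
      using \<delta>(2)[OF sub] by auto
  qed
  then obtain \<sigma> where \<sigma>: "\<And>i j. i < N \<Longrightarrow> j < N \<Longrightarrow> {pt i..pt (Suc i)} \<times> {pt j..pt (Suc j)} \<subseteq> U (\<sigma> i j)"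
    by metis
  define g where "g i j = h (pt i, pt j)" for i j
  have pt_Suc: "pt i \<le> pt (Suc i)" for i
    unfolding pt_def by (simp add: divide_right_mono)
  have lab: "0 < g i' j' (\<sigma> i j)" if "i < N" "j < N" "i' \<in> {i, Suc i}" "j' \<in> {j, Suc j}" for i j i' j'
  proof -
    have "(pt i', pt j') \<in> {pt i..pt (Suc i)} \<times> {pt j..pt (Suc j)}"
      using that pt_Suc by auto
    moreover have "(pt i', pt j') \<in> ?Q"
      using pt[of i'] pt[of j'] that by auto
    ultimately show ?thesis
      using \<sigma>[OF that(1,2)] U(2)[of "\<sigma> i j"] unfolding g_def by blast
  qed
  have pt0: "pt 0 = 0" and ptN: "pt N = 1"
    using N unfolding pt_def by auto
  have per: "g i N = g i 0" if "i \<le> N" for i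
    using h(5) pt[OF that] unfolding g_def pt0 ptN by auto
  have row0: "closes N (\<lambda>j. \<sigma> 0 (j mod N))"
  proof (rule closes_grid[OF N(1) _ lab _ per])
    show "g i j \<in> ?S" if "i \<le> N" "j \<le> N" for i j
      using pt[OF that(1)] pt[OF that(2)] h(2) unfolding g_def by auto
    show "g N j = ?c" if "j \<le> N" for j
      using h(4) pt[OF that] unfolding g_def ptN by auto
  qed auto
  have g0: "g 0 j = ?\<gamma> (pt j)" if "j \<le> N" for j
    using h(3) pt[OF that] unfolding g_def pt0 by auto
  have npt: "real n * pt j = real j / real k" for j
    using n k unfolding pt_def N_def by simp
  have lab0: "0 < g 0 j (\<sigma> 0 (j mod N))" if "j \<le> N" for j
    using lab[of 0 j 0 j] lab[of 0 0 0 0] per[of 0] N that by (cases "j = N") auto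
  have seg: "x \<in> {w m, w (Suc m)}" if "m < n" "m * k \<le> j" "j \<le> Suc m * k" "0 < g 0 j x" for m j x
  proof -
    have jN: "j \<le> N"
      using that(1,3) unfolding N_def by (metis Suc_leI le_trans mult_le_mono1)
    have "real (m * k) \<le> real j" "real j \<le> real (Suc m * k)"
      using that(2,3) by (simp_all only: of_nat_le_iff)
    then have b: "real m \<le> real n * pt j" "real n * pt j \<le> real (Suc m)"
      using k unfolding npt by (auto simp: field_simps)
    show ?thesis
      using that(4) unfolding g0[OF jN] polygon_segment[OF that(1) b]
      by (auto simp: indicator_def split: if_splits split_of_bool_asm)
  qed
  have vert: "x = w m" if "m \<le> n" "0 < g 0 (m * k) x" for m x
  proof -
    have jN: "m * k \<le> N"
      using that(1) unfolding N_def by simp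
    have e: "real n * pt (m * k) = real m"
      using k unfolding npt by simp
    show ?thesis
    proof (cases "m < n")
      case True
      show ?thesis
        using that(2) unfolding g0[OF jN] polygon_segment[OF True, of "pt (m * k)", unfolded e, OF order_refl, simplified]
        by (auto simp: indicator_def split: if_splits split_of_bool_asm)
    next
      case False
      then have "m = n" using that by simp
      then show ?thesis
        using that(2) wn \<gamma>1 ptN unfolding g0[OF jN] by (auto simp: N_def indicator_def split: if_splits)
    qed
  qed
  \<comment> \<open>The labels of row 0 are not the corners of the polygon, but on the stretch
    belonging to edge \<open>m\<close> they are end points of that edge. So this row and the slowed
    loop form one more ladder.\<close>
  have "closes N (\<lambda>j. w (j div k))"
  proof (rule closes_ladder[OF _ N(1) _ _ row0])
    fix j assume j: "j < N"
    define m where "m = j div k"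
    have m: "m < n" "m * k \<le> j" "Suc j \<le> Suc m * k"
      using j k unfolding m_def N_def
      by (auto simp: less_mult_imp_div_less div_times_less_eq_dividend Suc_le_eq dividend_less_div_times mult.commute[of n])
    have l1: "\<sigma> 0 (j mod N) \<in> {w m, w (Suc m)}"
      using seg[OF m(1,2) _ lab0] m(3) j by auto
    have l2: "\<sigma> 0 (Suc j mod N) \<in> {w m, w (Suc m)}"
      using seg[OF m(1) _ m(3) lab0] m(2) j by auto
    have "w (Suc j div k) \<in> {w m, w (Suc m)}"
      unfolding m_def by (simp add: div_Suc)
    then have "{w m, w (Suc j div k), \<sigma> 0 (j mod N), \<sigma> 0 (Suc j mod N)} \<subseteq> {w m, w (Suc m)}"
      using l1 l2 by blast
    then show "{w (j div k), w (Suc j div k), \<sigma> 0 (j mod N), \<sigma> 0 (Suc j mod N)} \<in> K"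
      unfolding m_def[symmetric] using w[OF m(1)] face by blast
  qed (use N k wn in \<open>auto simp: N_def\<close>)
  then show thesis
    using that[of k] k unfolding N_def by blast
qed

text \<open>By hypothesis \<open>\<mu>\<close> is the lift of its own image. Waiting steps lift to
  waiting steps by \<open>lift_self\<close>, so slowing the loop down does not change the end
  point.\<close>

lemma lifted_loop_closes:
  assumes sc: "simply_connected (geometric_realization K)"
    and \<mu>: "\<mu> 0 \<in> V" "\<And>i. i < n \<Longrightarrow> {\<phi> (\<mu> i), \<phi> (\<mu> (Suc i))} \<in> K"
      "\<And>i. i < n \<Longrightarrow> \<mu> (Suc i) = L (\<mu> i) (\<phi> (\<mu> (Suc i)))"
    and loop: "\<phi> (\<mu> n) = \<phi> (\<mu> 0)"
  shows "\<mu> n = \<mu> 0"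
proof (cases "n = 0")
  case False
  then obtain k where k: "0 < k" "closes (n * k) (\<lambda>j. \<phi> (\<mu> (j div k)))"
    using closes_polygon[OF sc, of n "\<lambda>i. \<phi> (\<mu> i)"] \<mu> loop by auto
  have inV: "\<mu> i \<in> V" if "i \<le> n" for i
    using that
  proof (induction i)
    case (Suc i)
    then show ?case
      using lift_in[of "\<mu> i" "\<phi> (\<mu> (Suc i))"] \<mu>(2,3)[of i] by simp
  qed (use \<mu> in simp)
  have "lift_walk (\<lambda>j. \<phi> (\<mu> (j div k))) (\<mu> 0) j = \<mu> (j div k)" if "j \<le> n * k" for j
    using that
  proof (induction j)
    case (Suc j)
    then have "j div k < n"
      by (simp add: less_mult_imp_div_less)
    then show ?case
      using Suc \<mu>(3)[of "j div k"] inV[of "j div k"] lift_self by (simp add: div_Suc)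
  qed simp
  from this[of "n * k"] show ?thesis
    using k \<mu>(1) unfolding closes_def by simp
qed simp

end

section \<open>Links of heptagonal vertices\<close>

definition cyclic_pairs :: "'a list \<Rightarrow> ('a \<times> 'a) set" where
  "cyclic_pairs xs = set (zip xs (rotate1 xs))"

lemma cyclic_pairs_nth:
  "cyclic_pairs xs = {(xs ! i, xs ! (Suc i mod length xs)) |i. i < length xs}"
  unfolding cyclic_pairs_def by (auto simp: set_zip nth_rotate1)

lemma cyclic_pairs_rotate1: "cyclic_pairs (rotate1 xs) = cyclic_pairs xs"
proof -
  have "zip (rotate1 xs) (rotate1 (rotate1 xs)) = rotate1 (zip xs (rotate1 xs))"
  proof (cases xs)
    case (Cons a ys)
    then show ?thesis
      using zip_append[of ys "tl (ys @ [a])" "[a]" "[hd (ys @ [a])]"] by (cases ys) auto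
  qed simp
  then show ?thesis
    unfolding cyclic_pairs_def by simp
qed

definition tri :: "'v set set \<Rightarrow> 'v \<Rightarrow> 'v \<Rightarrow> 'v \<Rightarrow> bool" where
  "tri K a b c \<longleftrightarrow> {a, b, c} \<in> triangles K"

lemma tri_swap: "tri K a b c \<Longrightarrow> tri K b a c" "tri K a b c \<Longrightarrow> tri K a c b"
  unfolding tri_def by (simp_all add: insert_commute)

lemma tri_comm: "tri K a b c = tri K b a c" "tri K a b c = tri K a c b"
  using tri_swap by metis+

lemma tri_distinct:
  assumes "tri K a b c"
  shows "a \<noteq> b" "a \<noteq> c" "b \<noteq> c"
  using assms unfolding tri_def triangles_def by (auto simp: card_insert_if split: if_splits)

definition wheel :: "'v set set \<Rightarrow> 'v \<Rightarrow> 'v list \<Rightarrow> bool" where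
  "wheel K v xs \<longleftrightarrow> length xs = 7 \<and> distinct xs \<and> v \<notin> set xs \<and>
     (\<forall>a b. tri K v a b \<longleftrightarrow> (a, b) \<in> cyclic_pairs xs \<or> (b, a) \<in> cyclic_pairs xs) \<and>
     (\<forall>a. a \<noteq> v \<longrightarrow> ({v, a} \<in> K \<longleftrightarrow> a \<in> set xs))"

lemma length_7_cases:
  assumes "length xs = 7"
  obtains x0 x1 x2 x3 x4 x5 x6 where "xs = [x0, x1, x2, x3, x4, x5, x6]"
  using assms by (auto simp: numeral_eq_Suc length_Suc_conv)

lemma cyclic_pairs_7:
  "cyclic_pairs [x0, x1, x2, x3, x4, x5, x6] =
     {(x0, x1), (x1, x2), (x2, x3), (x3, x4), (x4, x5), (x5, x6), (x6, x0)}"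
  unfolding cyclic_pairs_def by simp

lemma wheel_rotate: "wheel K v xs \<Longrightarrow> wheel K v (rotate k xs)"
  by (induction k) (auto simp: wheel_def cyclic_pairs_rotate1)

lemma wheel_rev:
  assumes "wheel K v xs"
  shows "wheel K v (rev xs)"
proof -
  have "length xs = 7"
    using assms unfolding wheel_def by simp
  then obtain x0 x1 x2 x3 x4 x5 x6 where xs: "xs = [x0, x1, x2, x3, x4, x5, x6]"
    by (rule length_7_cases)
  have "(a, b) \<in> cyclic_pairs (rev xs) \<longleftrightarrow> (b, a) \<in> cyclic_pairs xs" for a b
    unfolding xs by (auto simp: cyclic_pairs_7)
  then show ?thesis
    using assms unfolding wheel_def by auto
qed

lemma wheel_from_pair:
  assumes "wheel K v xs" "(a, b) \<in> cyclic_pairs xs"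
  shows "\<exists>x2 x3 x4 x5 x6. wheel K v [a, b, x2, x3, x4, x5, x6]"
proof -
  have len: "length xs = 7"
    using assms(1) unfolding wheel_def by simp
  obtain i where i: "i < length xs" "a = xs ! i" "b = xs ! (Suc i mod length xs)"
    using assms(2) unfolding cyclic_pairs_nth by blast
  have "length (rotate i xs) = 7"
    using len by simp
  then obtain x0 x1 x2 x3 x4 x5 x6 where xs: "rotate i xs = [x0, x1, x2, x3, x4, x5, x6]"
    by (rule length_7_cases)
  have "rotate i xs ! 0 = a" "rotate i xs ! 1 = b"
    using i len by (simp_all add: nth_rotate)
  then have "x0 = a" "x1 = b"
    unfolding xs by simp_all
  then show ?thesis
    using wheel_rotate[OF assms(1), of i] unfolding xs by blast
qed

text \<open>The dihedral symmetry of a wheel brings any ordered link edge to the front, which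
  amounts to choosing an orientation at \<open>v\<close>.\<close>

lemma wheel_from_tri:
  assumes "wheel K v xs" "tri K v a b"
  shows "\<exists>x2 x3 x4 x5 x6. wheel K v [a, b, x2, x3, x4, x5, x6]"
proof (cases "(a, b) \<in> cyclic_pairs xs")
  case True
  then show ?thesis
    by (rule wheel_from_pair[OF assms(1)])
next
  case False
  then have ba: "(b, a) \<in> cyclic_pairs xs"
    using assms unfolding wheel_def by blast
  have "length xs = 7"
    using assms unfolding wheel_def by simp
  then obtain x0 x1 x2 x3 x4 x5 x6 where xs: "xs = [x0, x1, x2, x3, x4, x5, x6]"
    by (rule length_7_cases)
  have "(a, b) \<in> cyclic_pairs (rev xs)"
    using ba unfolding xs by (auto simp: cyclic_pairs_7)
  then show ?thesis
    by (rule wheel_from_pair[OF wheel_rev[OF assms(1)]])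
qed

lemma triangle_at_vertex:
  assumes K: "abstract_complex K"
  shows "insert v e \<in> triangles K \<and> v \<notin> e \<longleftrightarrow> e \<in> vertex_link K v \<and> card e = 2"
proof
  assume t: "insert v e \<in> triangles K \<and> v \<notin> e"
  then have c: "card e = 2"
    unfolding triangles_def by (cases "finite e") auto
  then have "e \<noteq> {}"
    by auto
  then have "e \<in> K"
    using t abstract_complex_face[OF K, of "insert v e" e] unfolding triangles_def by auto
  then show "e \<in> vertex_link K v \<and> card e = 2"
    using t c unfolding triangles_def vertex_link_def by simp
next
  assume e: "e \<in> vertex_link K v \<and> card e = 2"
  then have "finite e"
    using card.infinite by fastforce
  then show "insert v e \<in> triangles K \<and> v \<notin> e"
    using e unfolding triangles_def vertex_link_def by simp
qed

text \<open>The circle comes with unspecified length. Its edges correspond bijectively to the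
  triangles at \<open>v\<close>, so the degree condition makes the length seven.\<close>

lemma wheel_exists:
  assumes X7: "X7 K" and v: "v \<in> vertices K"
  shows "\<exists>xs. wheel K v xs"
proof -
  have K: "abstract_complex K"
    using X7 unfolding X7_def triangulated_surface_def by simp
  have circ: "is_circle (vertex_link K v)"
    using X7 v unfolding X7_def triangulated_surface_def by simp
  have c7: "card {t \<in> triangles K. v \<in> t} = 7"
    using X7 v unfolding X7_def by simp
  obtain xs where xs: "distinct xs" "3 \<le> length xs"
    and link: "vertex_link K v = {{xs ! i} |i. i < length xs} \<union>
            {{xs ! i, xs ! (Suc i mod length xs)} |i. i < length xs}"
    using circ unfolding is_circle_def by blast
  let ?n = "length xs"
  define e where "e i = {xs ! i, xs ! (Suc i mod ?n)}" for i
  have sm: "Suc i mod ?n < ?n" "Suc i mod ?n \<noteq> i" if "i < ?n" for i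
    using that xs(2) by (auto simp: mod_Suc)
  have e2: "card (e i) = 2" if "i < ?n" for i
    using sm[OF that] that xs(1) unfolding e_def by (simp add: nth_eq_iff_index_eq card_insert_if)
  have link2: "s \<in> vertex_link K v \<and> card s = 2 \<longleftrightarrow> s \<in> e ` {..<?n}" for s
  proof
    assume s: "s \<in> vertex_link K v \<and> card s = 2"
    then have "s \<notin> {{xs ! i} |i. i < length xs}"
      by auto
    then show "s \<in> e ` {..<?n}"
      using s unfolding link e_def by auto
  next
    assume "s \<in> e ` {..<?n}"
    then show "s \<in> vertex_link K v \<and> card s = 2"
      using e2 unfolding link e_def by blast
  qed
  have vout: "v \<notin> s" if "s \<in> vertex_link K v" for s
    using that unfolding vertex_link_def by simp
  have vxs: "v \<notin> set xs"
  proof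
    assume "v \<in> set xs"
    then obtain i where "i < ?n" "v = xs ! i"
      by (metis in_set_conv_nth)
    then have "{v} \<in> vertex_link K v"
      unfolding link by blast
    then show False
      using vout by blast
  qed
  \<comment> \<open>Length at least three rules out that two positions give the same edge in
    opposite directions.\<close>
  have inj_e: "inj_on e {..<?n}"
  proof (rule inj_onI)
    fix i j assume ij: "i \<in> {..<?n}" "j \<in> {..<?n}" "e i = e j"
    then have "(i = j \<and> Suc i mod ?n = Suc j mod ?n) \<or> (i = Suc j mod ?n \<and> Suc i mod ?n = j)"
      using xs(1) sm unfolding e_def by (auto simp: doubleton_eq_iff nth_eq_iff_index_eq)
    then show "i = j"
      using ij(1,2) xs(2) by (auto simp: mod_Suc split: if_splits)
  qed
  have "{t \<in> triangles K. v \<in> t} = insert v ` e ` {..<?n}"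
  proof (rule set_eqI)
    fix t
    have "t \<in> {t \<in> triangles K. v \<in> t} \<longleftrightarrow> (\<exists>s. t = insert v s \<and> insert v s \<in> triangles K \<and> v \<notin> s)"
      by (metis (mono_tags, lifting) insertI1 mem_Collect_eq mk_disjoint_insert)
    then show "t \<in> {t \<in> triangles K. v \<in> t} \<longleftrightarrow> t \<in> insert v ` e ` {..<?n}"
      unfolding triangle_at_vertex[OF K] link2 by blast
  qed
  moreover have "inj_on (insert v) (e ` {..<?n})"
  proof (rule inj_onI)
    fix s t assume "s \<in> e ` {..<?n}" "t \<in> e ` {..<?n}" "insert v s = insert v t"
    moreover from this have "v \<notin> s" "v \<notin> t"
      using vout link2 by blast+
    ultimately show "s = t"
      by (metis insert_ident)
  qed
  ultimately have n: "?n = 7"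
    using c7 inj_e by (simp add: card_image)
  have cp: "{a, b} \<in> e ` {..<?n} \<longleftrightarrow> (a, b) \<in> cyclic_pairs xs \<or> (b, a) \<in> cyclic_pairs xs" for a b
    unfolding cyclic_pairs_nth e_def image_iff by (auto simp: doubleton_eq_iff)
  have tri: "tri K v a b \<longleftrightarrow> (a, b) \<in> cyclic_pairs xs \<or> (b, a) \<in> cyclic_pairs xs" for a b
  proof -
    have "tri K v a b \<longleftrightarrow> insert v {a, b} \<in> triangles K \<and> v \<notin> {a, b}"
      using tri_distinct[of K v a b] unfolding tri_def by auto
    then show ?thesis
      unfolding triangle_at_vertex[OF K] link2 cp .
  qed
  have edge: "{v, a} \<in> K \<longleftrightarrow> a \<in> set xs" if "a \<noteq> v" for a
  proof -
    have "{v, a} \<in> K \<longleftrightarrow> {a} \<in> vertex_link K v"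
      using that abstract_complex_face[OF K, of "{v, a}" "{a}"] unfolding vertex_link_def by auto
    also have "\<dots> \<longleftrightarrow> (\<exists>i<?n. a = xs ! i)"
    proof
      assume "{a} \<in> vertex_link K v"
      then show "\<exists>i<?n. a = xs ! i"
        unfolding link by (auto simp: singleton_insert_inj_eq')
    qed (auto simp: link)
    also have "\<dots> \<longleftrightarrow> a \<in> set xs"
      by (auto simp: in_set_conv_nth)
    finally show ?thesis .
  qed
  show ?thesis
    unfolding wheel_def using n xs(1) vxs tri edge by blast
qed

locale heptagonal =
  fixes K :: "'v set set"
  assumes X7: "X7 K"
begin

lemma complex: "abstract_complex K"
  using X7 unfolding X7_def triangulated_surface_def by simp

lemma tri_vertex: "tri K a b c \<Longrightarrow> a \<in> vertices K"
  unfolding tri_def triangles_def vertices_def by blast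

lemma tri_wheel: "tri K v a b \<Longrightarrow> \<exists>x2 x3 x4 x5 x6. wheel K v [a, b, x2, x3, x4, x5, x6]"
  using wheel_exists[OF X7 tri_vertex] wheel_from_tri by metis

text \<open>In the wheel at \<open>v\<close> the neighbour \<open>a\<close> has just two link
  neighbours. This rule later identifies wheel entries that have been developed from
  elsewhere.\<close>

lemma tri_third:
  assumes "tri K v a c" "tri K v a d" "tri K v a e" "c \<noteq> d" "c \<noteq> e"
  shows "d = e"
proof -
  obtain x2 x3 x4 x5 x6 where w: "wheel K v [c, a, x2, x3, x4, x5, x6]"
    using tri_wheel tri_swap(2)[OF assms(1)] by blast
  have "d = x2" "e = x2"
    using w assms unfolding wheel_def cyclic_pairs_7 by auto
  then show ?thesis
    by simp
qed

end

lemma wheel_7: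
  "wheel K v [x0, x1, x2, x3, x4, x5, x6] \<Longrightarrow>
     tri K v x0 x1 \<and> tri K v x1 x2 \<and> tri K v x2 x3 \<and> tri K v x3 x4 \<and> tri K v x4 x5 \<and> tri K v x5 x6 \<and>
     tri K v x6 x0 \<and> distinct [x0, x1, x2, x3, x4, x5, x6]"
  unfolding wheel_def cyclic_pairs_7 by simp

section \<open>A layered model of the tiling\<close>

text \<open>Vertices of the model are lists of digits, innermost digit last, so that the length of the list is
  the distance to the centre \<open>[]\<close>. If \<open>x \<noteq> []\<close>, the vertex \<open>0 # x\<close> is the apex of the triangle standing
  on the edge from \<open>left_of x\<close> to \<open>x\<close>; it has two neighbours in the layer below,
  the other vertices \<open>d # x\<close> only one. Seven minus the inner neighbours, the two in the layer and the last
  outer neighbour \<open>0 # right_of x\<close> leaves the number \<open>kids x\<close> of digits that may precede \<open>x\<close>.\<close>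

definition apex :: "nat list \<Rightarrow> bool" where
  "apex p \<longleftrightarrow> p \<noteq> [] \<and> hd p = 0 \<and> tl p \<noteq> []"

definition kids :: "nat list \<Rightarrow> nat" where
  "kids p = (if p = [] then 7 else if apex p then 2 else 3)"

primrec valid :: "nat list \<Rightarrow> bool" where
  "valid [] \<longleftrightarrow> True"
| "valid (d # x) \<longleftrightarrow> valid x \<and> d < kids x"

text \<open>The last kid of \<open>x\<close> is followed by the first kid of
  \<open>right_of x\<close>. The value at \<open>[]\<close> makes this rule close layer one into a
  cycle, \<open>[6]\<close> being followed by \<open>[0]\<close>.\<close>

primrec right_of :: "nat list \<Rightarrow> nat list" where
  "right_of [] = []"
| "right_of (d # x) = (if Suc d < kids x then Suc d # x else 0 # right_of x)"

primrec left_of :: "nat list \<Rightarrow> nat list" where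
  "left_of [] = []"
| "left_of (d # x) = (if 0 < d then (d - 1) # x else (kids (left_of x) - 1) # left_of x)"

lemma apex_Cons [simp]: "apex (d # x) \<longleftrightarrow> d = 0 \<and> x \<noteq> []"
  unfolding apex_def by simp

lemma kids_Nil [simp]: "kids [] = 7"
  unfolding kids_def by simp

lemma kids_ge_2: "2 \<le> kids p"
  unfolding kids_def by simp

lemma length_right_of [simp]: "length (right_of p) = length p"
  by (induction p) auto

lemma length_left_of [simp]: "length (left_of p) = length p"
  by (induction p) auto

lemma right_of_eq_Nil [simp]: "right_of p = [] \<longleftrightarrow> p = []"
  by (metis length_0_conv length_right_of)

lemma left_of_eq_Nil [simp]: "left_of p = [] \<longleftrightarrow> p = []"
  by (metis length_0_conv length_left_of)

lemma valid_right_of: "valid p \<Longrightarrow> valid (right_of p)"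
proof (induction p)
  case (Cons d x)
  then show ?case
    using kids_ge_2[of "right_of x"] by auto
qed simp

lemma valid_left_of: "valid p \<Longrightarrow> valid (left_of p)"
proof (induction p)
  case (Cons d x)
  then show ?case
    using kids_ge_2[of "left_of x"] by auto
qed simp

lemma left_of_right_of: "valid p \<Longrightarrow> left_of (right_of p) = p"
proof (induction p)
  case (Cons d x)
  then show ?case
    using kids_ge_2[of x] by auto
qed simp

lemma right_of_left_of: "valid p \<Longrightarrow> right_of (left_of p) = p"
proof (induction p)
  case (Cons d x)
  then show ?case
    using kids_ge_2[of "left_of x"] by auto
qed simp

text \<open>The inner neighbour that comes just before \<open>left_of p\<close> in the cyclic order,
  so that the tour round \<open>p\<close> starts alike with one or two inner neighbours.\<close>

definition left_parent :: "nat list \<Rightarrow> nat list" where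
  "left_parent p = (if apex p then left_of (tl p) else tl p)"

lemma length_left_parent: "p \<noteq> [] \<Longrightarrow> length (left_parent p) < length p"
  unfolding left_parent_def by simp

lemma left_parent_right_of: "valid p \<Longrightarrow> p \<noteq> [] \<Longrightarrow> left_parent (right_of p) = tl p"
  by (cases p) (auto simp: left_parent_def left_of_right_of)

text \<open>The neighbours in cyclic order around \<open>p\<close>.\<close>

definition nbrs :: "nat list \<Rightarrow> nat list list" where
  "nbrs p =
     (if p = [] then [[0], [1], [2], [3], [4], [5], [6]]
      else if apex p then [left_of (tl p), left_of p, 0 # p, 1 # p, 0 # right_of p, right_of p, tl p]
      else [tl p, left_of p, 0 # p, 1 # p, 2 # p, 0 # right_of p, right_of p])"

section \<open>Developing the model into the complex\<close>

locale development = heptagonal K for K :: "'v set set" +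
  fixes v :: 'v and hub :: "'v list"
  assumes hub: "wheel K v hub"
begin

text \<open>Where \<open>tri K c a b\<close> holds, the first two entries determine the whole
  listing, so the choice is harmless.\<close>

definition spokes :: "'v \<Rightarrow> 'v \<Rightarrow> 'v \<Rightarrow> 'v list" where
  "spokes c a b = (SOME xs. wheel K c xs \<and> xs ! 0 = a \<and> xs ! 1 = b)"

lemma spokes:
  assumes "tri K c a b"
  shows "\<exists>x2 x3 x4 x5 x6. spokes c a b = [a, b, x2, x3, x4, x5, x6] \<and> wheel K c [a, b, x2, x3, x4, x5, x6]"
proof -
  obtain x2 x3 x4 x5 x6 where w: "wheel K c [a, b, x2, x3, x4, x5, x6]"
    using tri_wheel[OF assms] by blast
  have s: "wheel K c (spokes c a b) \<and> spokes c a b ! 0 = a \<and> spokes c a b ! 1 = b"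
    unfolding spokes_def by (rule someI[where P = "\<lambda>xs. wheel K c xs \<and> xs ! 0 = a \<and> xs ! 1 = b" and x = "[a, b, x2, x3, x4, x5, x6]"])
      (simp add: w)
  then have "length (spokes c a b) = 7"
    unfolding wheel_def by simp
  then obtain y0 y1 y2 y3 y4 y5 y6 where y: "spokes c a b = [y0, y1, y2, y3, y4, y5, y6]"
    by (rule length_7_cases)
  then show ?thesis
    using s y by auto
qed

text \<open>Entries 0 and 1 of the spokes are the images of \<open>left_parent x\<close> and
  \<open>left_of x\<close>, whence the offset 2. These arguments need not be tails of
  \<open>d # x\<close>, so the recursion is on length. An apex is developed from its right parent
  \<open>x\<close> only; that the left parent sees the same vertex has to be proved.\<close>

function develop :: "nat list \<Rightarrow> 'v" where
  "develop [] = v"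
| "develop (d # x) = (if x = [] then hub ! d else spokes (develop x) (develop (left_parent x)) (develop (left_of x)) ! (d + 2))"
  by pat_completeness auto
termination
  by (relation "inv_image less_than length") (auto simp: length_left_parent less_Suc_eq)

text \<open>\<open>pregood p\<close> says that the part of the link lying in the layers up to that of \<open>p\<close> is developed correctly.
  The rest of the link closes up because an edge lies in only two triangles.\<close>

definition good :: "nat list \<Rightarrow> bool" where
  "good p \<longleftrightarrow> wheel K (develop p) (map develop (nbrs p))"

definition pregood :: "nat list \<Rightarrow> bool" where
  "pregood p \<longleftrightarrow> tri K (develop p) (develop (left_parent p)) (develop (left_of p)) \<and> tri K (develop p) (develop (tl p)) (develop (right_of p)) \<and>
     (if apex p then tri K (develop p) (develop (left_parent p)) (develop (tl p)) \<and> develop (tl p) \<noteq> develop (left_of p) \<and> develop (right_of p) \<noteq> develop (left_parent p)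
      else develop (right_of p) \<noteq> develop (left_of p))"

lemma pregood_wheel:
  assumes "pregood p" "p \<noteq> []"
  shows "\<exists>x4 x5 x6. wheel K (develop p) [develop (left_parent p), develop (left_of p), develop (0 # p), develop (1 # p), x4, x5, x6] \<and>
    develop (2 # p) = x4"
proof -
  obtain x2 x3 x4 x5 x6 where sp: "spokes (develop p) (develop (left_parent p)) (develop (left_of p)) = [develop (left_parent p), develop (left_of p), x2, x3, x4, x5, x6]"
    and w: "wheel K (develop p) [develop (left_parent p), develop (left_of p), x2, x3, x4, x5, x6]"
    using spokes[of "develop p" "develop (left_parent p)" "develop (left_of p)"] assms(1) unfolding pregood_def by blast
  have "develop (0 # p) = x2" "develop (1 # p) = x3" "develop (2 # p) = x4"
    using assms(2) sp by simp_all
  then show ?thesis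
    using w by auto
qed

text \<open>The forward entries hold by construction. The remaining ones are found backwards round
  the link, each as the third vertex across an edge with one triangle already known. The last outer
  neighbour was developed from \<open>right_of p\<close>, which is why that vertex must be pregood
  too.\<close>

lemma pregood_imp_good:
  assumes p: "pregood p" and q: "pregood (right_of p)" and val: "valid p" and ne: "p \<noteq> []"
  shows "good p"
proof -
  obtain x4 x5 x6 where w: "wheel K (develop p) [develop (left_parent p), develop (left_of p), develop (0 # p), develop (1 # p), x4, x5, x6]"
    and x4: "develop (2 # p) = x4"
    using pregood_wheel[OF p ne] by blast
  note W = wheel_7[OF w]
  obtain y4 y5 y6 where w': "wheel K (develop (right_of p)) [develop (left_parent (right_of p)), develop (left_of (right_of p)), develop (0 # right_of p), develop (1 # right_of p), y4, y5, y6]"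
    using pregood_wheel[OF q] ne by auto
  have n1: "tri K (develop p) (develop (right_of p)) (develop (0 # right_of p))"
    using wheel_7[OF w'] by (simp add: left_of_right_of[OF val] tri_comm del: develop.simps)
  \<comment> \<open>Both are entries of the wheel at \<open>right_of p\<close>, at positions 2 and
    0, because \<open>tl p\<close> is the left parent of \<open>right_of p\<close>.\<close>
  have n2: "develop (0 # right_of p) \<noteq> develop (tl p)"
    using wheel_7[OF w'] by (auto simp: left_parent_right_of[OF val ne] simp del: develop.simps)
  have pt: "tri K (develop p) (develop (right_of p)) (develop (tl p))"
    using p unfolding pregood_def by (simp add: tri_comm)
  show ?thesis
  proof (cases "apex p")
    case True
    then have P: "tri K (develop p) (develop (left_parent p)) (develop (tl p))" "develop (tl p) \<noteq> develop (left_of p)" "develop (right_of p) \<noteq> develop (left_parent p)"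
      using p unfolding pregood_def by auto
    have x6: "x6 = develop (tl p)"
      by (rule tri_third[of "develop p" "develop (left_parent p)" "develop (left_of p)"]) (use W P in \<open>auto simp: tri_comm simp del: develop.simps\<close>)
    have x5: "x5 = develop (right_of p)"
      by (rule tri_third[of "develop p" "develop (tl p)" "develop (left_parent p)"]) (use W P pt x6 in \<open>auto simp: tri_comm simp del: develop.simps\<close>)
    have "x4 = develop (0 # right_of p)"
      by (rule tri_third[of "develop p" "develop (right_of p)" "develop (tl p)"]) (use W P n1 n2 pt x5 x6 in \<open>auto simp: tri_comm simp del: develop.simps\<close>)
    then show ?thesis
      using w x5 x6 True ne unfolding good_def nbrs_def by (simp add: left_parent_def del: develop.simps)
  next
    case False
    then have P: "develop (right_of p) \<noteq> develop (left_of p)" and l: "left_parent p = tl p"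
      using p unfolding pregood_def left_parent_def by auto
    have x6: "x6 = develop (right_of p)"
      by (rule tri_third[of "develop p" "develop (tl p)" "develop (left_of p)"]) (use W P pt l in \<open>auto simp: tri_comm simp del: develop.simps\<close>)
    have "x5 = develop (0 # right_of p)"
      by (rule tri_third[of "develop p" "develop (right_of p)" "develop (tl p)"]) (use W P n1 n2 pt x6 l in \<open>auto simp: tri_comm simp del: develop.simps\<close>)
    then show ?thesis
      using w x4 x6 False ne l unfolding good_def nbrs_def by (simp del: develop.simps)
  qed
qed

text \<open>What the wheel at a parent supplies towards pregoodness of the vertices above
  it.\<close>

lemma good_kids:
  assumes "good x" "x \<noteq> []" "valid x"
  shows "tri K (develop x) (develop (left_of x)) (develop (0 # x))"
    and "\<And>d. d < kids x \<Longrightarrow> tri K (develop x) (develop (d # x)) (develop (right_of (d # x)))"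
    and "tri K (develop x) (develop (0 # right_of x)) (develop (right_of x))"
    and "develop (left_of x) \<noteq> develop (1 # x)"
    and "\<And>d. d < kids x \<Longrightarrow> 0 < d \<Longrightarrow> develop (right_of (d # x)) \<noteq> develop (left_of (d # x))"
    and "\<And>d. d < kids x \<Longrightarrow> develop (d # x) \<noteq> develop (right_of x)"
proof -
  have d: "d = 0 \<or> d = 1 \<or> d = 2 \<and> \<not> apex x" if "d < kids x" for d
    using that assms(2) unfolding kids_def by (auto split: if_splits)
  have k: "kids x = (if apex x then 2 else 3)"
    using assms(2) unfolding kids_def by simp
  note W = assms(1)[unfolded good_def nbrs_def]
  show "tri K (develop x) (develop (left_of x)) (develop (0 # x))"
    using W assms(2) by (auto dest!: wheel_7 simp del: develop.simps split: if_splits)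
  show "tri K (develop x) (develop (0 # right_of x)) (develop (right_of x))"
    using W assms(2) by (auto dest!: wheel_7 simp del: develop.simps split: if_splits)
  show "develop (left_of x) \<noteq> develop (1 # x)"
    using W assms(2) by (auto dest!: wheel_7 simp del: develop.simps split: if_splits)
  show "tri K (develop x) (develop (d # x)) (develop (right_of (d # x)))" if "d < kids x" for d
    using W assms(2) d[OF that] by (auto dest!: wheel_7 simp: k numeral_2_eq_2 simp del: develop.simps split: if_splits)
  show "develop (right_of (d # x)) \<noteq> develop (left_of (d # x))" if "d < kids x" "0 < d" for d
    using W assms(2) d[OF that(1)] that(2) by (auto dest!: wheel_7 simp: k numeral_2_eq_2 simp del: develop.simps split: if_splits)
  show "develop (d # x) \<noteq> develop (right_of x)" if "d < kids x" for d
    using W assms(2) d[OF that] by (auto dest!: wheel_7 simp: k numeral_2_eq_2 simp del: develop.simps split: if_splits)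
qed

text \<open>Kid 0 is an apex and needs the wheels at both its parents; for the other kids the wheel
  at \<open>x\<close> suffices.\<close>

lemma pregood_Cons:
  assumes x: "good x" "good (left_of x)" "x \<noteq> []" "valid x" and d: "d < kids x"
  shows "pregood (d # x)"
proof (cases "d = 0")
  case True
  \<comment> \<open>The last digit available over \<open>left_of x\<close>:
    \<open>?k # left_of x\<close> is the left neighbour of \<open>0 # x\<close>.\<close>
  let ?k = "kids (left_of x) - 1"
  have ne: "left_of x \<noteq> []" and val: "valid (left_of x)"
    using x valid_left_of by auto
  have k: "?k < kids (left_of x)" "right_of (?k # left_of x) = 0 # x"
    using kids_ge_2[of "left_of x"] right_of_left_of[OF x(4)] by auto
  note g = good_kids[OF x(2) ne val, unfolded right_of_left_of[OF x(4)]]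
  note h = good_kids[OF x(1,3,4)]
  have n: "right_of (0 # x) = 1 # x"
    using kids_ge_2[of x] by simp
  have "tri K (develop (0 # x)) (develop (left_of x)) (develop (?k # left_of x))"
    using g(2)[OF k(1)] unfolding k(2) by (simp only: tri_comm)
  moreover have "tri K (develop (0 # x)) (develop x) (develop (1 # x))"
    using h(2)[of 0, unfolded n] d True by (simp only: tri_comm)
  moreover have "tri K (develop (0 # x)) (develop (left_of x)) (develop x)"
    using h(1) by (simp only: tri_comm)
  moreover have "develop x \<noteq> develop (?k # left_of x)"
    using g(6)[OF k(1)] by simp
  moreover have "develop (1 # x) \<noteq> develop (left_of x)"
    using h(4) by simp
  ultimately show ?thesis
    using True x(3) n unfolding pregood_def left_parent_def by (simp del: develop.simps right_of.simps)
next
  case False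
  note h = good_kids[OF x(1,3,4)]
  have "right_of ((d - 1) # x) = d # x"
    using d False by simp
  then have "tri K (develop x) (develop ((d - 1) # x)) (develop (d # x))"
    using h(2)[of "d - 1"] d by (simp del: right_of.simps develop.simps)
  then have "tri K (develop (d # x)) (develop x) (develop (left_of (d # x)))"
    using False by (simp add: tri_comm del: develop.simps)
  moreover have "tri K (develop (d # x)) (develop x) (develop (right_of (d # x)))"
    using h(2)[OF d] by (simp only: tri_comm)
  moreover have "develop (right_of (d # x)) \<noteq> develop (left_of (d # x))"
    using h(5)[OF d] False by simp
  ultimately show ?thesis
    using False unfolding pregood_def left_parent_def by (simp del: develop.simps right_of.simps left_of.simps)
qed

lemma hub_list: "hub = map develop (nbrs [])"
proof -
  have "length hub = 7"
    using hub unfolding wheel_def by simp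
  then show ?thesis
    unfolding nbrs_def by (auto elim!: length_7_cases)
qed

lemma good_Nil: "good []"
  using hub hub_list unfolding good_def by simp

lemma pregood_singleton:
  assumes "d < 7"
  shows "pregood [d]"
proof -
  have d: "d \<in> {0, 1, 2, 3, 4, 5, 6}"
    using assms by auto
  have "wheel K v [develop [0], develop [1], develop [2], develop [3], develop [4], develop [5], develop [6]]"
    using hub hub_list unfolding nbrs_def by simp
  note W = wheel_7[OF this]
  have right_of: "right_of [d] = [if d = 6 then 0 else Suc d]" and left_of: "left_of [d] = [if d = 0 then 6 else d - 1]"
    using assms by auto
  have "tri K v (develop [d]) (develop (right_of [d]))" "tri K v (develop (left_of [d])) (develop [d])" "develop (right_of [d]) \<noteq> develop (left_of [d])"
    unfolding right_of left_of using d W by (auto simp: eval_nat_numeral simp del: develop.simps)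
  then show ?thesis
    unfolding pregood_def left_parent_def by (simp add: tri_comm del: develop.simps(2) right_of.simps left_of.simps)
qed

text \<open>The induction treats whole layers, since goodness of a vertex involves its right
  neighbour and an apex involves the left neighbour of its parent.\<close>

lemma pregood:
  assumes "valid p" "p \<noteq> []"
  shows "pregood p"
proof -
  have "\<forall>p. valid p \<longrightarrow> length p = Suc n \<longrightarrow> pregood p" for n
  proof (induction n)
    case 0
    then show ?case
      using pregood_singleton by (auto simp: length_Suc_conv)
  next
    case (Suc n)
    show ?case
    proof (intro allI impI)
      fix p assume p: "valid p" "length p = Suc (Suc n)"
      then obtain d x where dx: "p = d # x" "length x = Suc n" "valid x" "d < kids x"
        by (cases p) auto
      have "good q" if "length q = Suc n" "valid q" for q
        using that Suc by (intro pregood_imp_good) (auto intro: valid_right_of)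
      then show "pregood p"
        using dx valid_left_of by (auto intro!: pregood_Cons)
    qed
  qed
  then show ?thesis
    using assms by (cases p) auto
qed

lemma develop_wheel:
  assumes "valid p"
  shows "wheel K (develop p) (map develop (nbrs p))"
proof (cases "p = []")
  case False
  then show ?thesis
    using pregood_imp_good[OF pregood pregood] assms valid_right_of unfolding good_def by auto
qed (use good_Nil good_def in auto)

end

section \<open>Adjacency in the model\<close>

lemma apex_Nil [simp]: "\<not> apex []"
  unfolding apex_def by simp

lemma nbrs_simps:
  "nbrs [] = [[0], [1], [2], [3], [4], [5], [6]]"
  "apex p \<Longrightarrow> nbrs p = [left_of (tl p), left_of p, 0 # p, 1 # p, 0 # right_of p, right_of p, tl p]"
  "p \<noteq> [] \<Longrightarrow> \<not> apex p \<Longrightarrow> nbrs p = [tl p, left_of p, 0 # p, 1 # p, 2 # p, 0 # right_of p, right_of p]"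
  unfolding nbrs_def apex_def by auto

lemma kids_simps: "apex p \<Longrightarrow> kids p = 2" "p \<noteq> [] \<Longrightarrow> \<not> apex p \<Longrightarrow> kids p = 3"
  unfolding kids_def apex_def by auto

lemma in_nbrs:
  assumes "p \<noteq> []"
  shows "right_of p \<in> set (nbrs p)" "left_of p \<in> set (nbrs p)" "tl p \<in> set (nbrs p)" "0 # right_of p \<in> set (nbrs p)"
    "left_parent p \<in> set (nbrs p)" "apex p \<Longrightarrow> left_of (tl p) \<in> set (nbrs p)"
  using assms by (cases "apex p"; simp add: nbrs_simps left_parent_def)+

lemma kid_in_nbrs:
  assumes "d < kids p"
  shows "d # p \<in> set (nbrs p)"
proof -
  consider "p = []" | "apex p" | "p \<noteq> []" "\<not> apex p"
    by blast
  then show ?thesis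
  proof cases
    case 1
    then have "d \<in> {0, 1, 2, 3, 4, 5, 6}"
      using assms by auto
    then show ?thesis
      using 1 by (auto simp: nbrs_simps)
  next
    case 2
    then have "d \<in> {0, 1}"
      using assms by (auto simp: kids_simps)
    then show ?thesis
      using 2 by (auto simp: nbrs_simps)
  next
    case 3
    then have "d \<in> {0, 1, 2}"
      using assms by (auto simp: kids_simps)
    then show ?thesis
      using 3 by (auto simp: nbrs_simps)
  qed
qed

lemma valid_tl: "valid p \<Longrightarrow> valid (tl p)"
  by (cases p) auto

lemma in_nbrs_tl: "valid p \<Longrightarrow> p \<noteq> [] \<Longrightarrow> p \<in> set (nbrs (tl p))"
  using kid_in_nbrs by (cases p) auto

lemma valid_nbrs:
  assumes "valid p" "q \<in> set (nbrs p)"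
  shows "valid q"
proof -
  have "0 < kids (right_of p)"
    using kids_ge_2[of "right_of p"] by simp
  then show ?thesis
    using assms valid_tl[OF assms(1)] valid_right_of[OF assms(1)] valid_left_of[OF assms(1)] valid_left_of[OF valid_tl[OF assms(1)]]
    by (cases "p = []"; cases "apex p") (auto simp: nbrs_simps kids_simps)
qed

text \<open>The entry \<open>0 # right_of p\<close> at \<open>p\<close> is matched by the entry
  \<open>left_of (tl q)\<close> at the apex \<open>q\<close>; the other kinds of entry pair off as
  left with right and parent with kid.\<close>

lemma nbrs_sym:
  assumes p: "valid p" and q: "q \<in> set (nbrs p)"
  shows "p \<in> set (nbrs q)"
proof (cases "p = []")
  case True
  then show ?thesis
    using q in_nbrs(3)[of q] by (auto simp: nbrs_simps)
next
  case False
  have "p \<in> set (nbrs (tl p))"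
    using in_nbrs_tl[OF p False] .
  moreover have "p \<in> set (nbrs (left_of p))"
    using in_nbrs(1)[of "left_of p"] False by (simp add: right_of_left_of[OF p])
  moreover have "p \<in> set (nbrs (right_of p))"
    using in_nbrs(2)[of "right_of p"] False by (simp add: left_of_right_of[OF p])
  moreover have "p \<in> set (nbrs (d # p))" for d
    using in_nbrs(3)[of "d # p"] by simp
  moreover have "p \<in> set (nbrs (0 # right_of p))"
    using in_nbrs(6)[of "0 # right_of p"] False by (simp add: left_of_right_of[OF p])
  moreover have "p \<in> set (nbrs (left_of (tl p)))" if ap: "apex p"
  proof -
    obtain x where x: "p = 0 # x" "x \<noteq> []"
      using ap by (cases p) auto
    then have "0 # right_of (left_of (tl p)) = p" and ne: "left_of (tl p) \<noteq> []"
      using right_of_left_of[of x] p by auto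
    then show ?thesis
      using in_nbrs(4)[OF ne] by simp
  qed
  ultimately show ?thesis
    using q False by (cases "apex p") (auto simp: nbrs_simps)
qed

text \<open>Ensures that a triangle of \<open>K\<close> lifts to three pairwise adjacent vertices,
  as the covering law \<open>lift_lift\<close> requires.\<close>

lemma nbrs_consecutive:
  assumes p: "valid p" and qr: "(q, r) \<in> cyclic_pairs (nbrs p)"
  shows "r \<in> set (nbrs q)"
proof (cases "p = []")
  case True
  have "q \<noteq> []" "r = right_of q"
    using qr by (auto simp: True nbrs_simps(1) cyclic_pairs_7)
  then show ?thesis
    using in_nbrs(1) by simp
next
  case False
  have val: "valid (left_of p)" "valid (left_of (tl p))" "valid (right_of p)"
    using p by (simp_all add: valid_right_of valid_left_of valid_tl)
  have a: "0 # p \<in> set (nbrs (left_of p))"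
    using in_nbrs(4)[of "left_of p"] False by (simp add: right_of_left_of[OF p])
  have b: "1 # p \<in> set (nbrs (0 # p))"
    using in_nbrs(1)[of "0 # p"] kids_ge_2[of p] by simp
  have c: "0 # right_of p \<in> set (nbrs ((kids p - 1) # p))"
    using in_nbrs(1)[of "(kids p - 1) # p"] kids_ge_2[of p] by simp
  have d: "right_of p \<in> set (nbrs (0 # right_of p))"
    using in_nbrs(3)[of "0 # right_of p"] by simp
  have e: "tl p \<in> set (nbrs (right_of p))"
    using in_nbrs(5)[of "right_of p"] False by (simp add: left_parent_right_of[OF p])
  show ?thesis
  proof (cases "apex p")
    case True
    have "left_of p \<in> set (nbrs (left_of (tl p)))"
      using in_nbrs_tl[OF val(1)] True by (cases p) auto
    moreover have "left_of (tl p) \<in> set (nbrs (tl p))"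
      using True in_nbrs(2) unfolding apex_def by blast
    moreover have "0 # right_of p \<in> set (nbrs (1 # p))"
      using c True by (simp add: kids_simps)
    ultimately show ?thesis
      using qr[unfolded nbrs_simps(2)[OF True] cyclic_pairs_7] a b d e by auto
  next
    case na: False
    have "left_of p \<in> set (nbrs (tl p))"
      using in_nbrs_tl[OF val(1)] na False by (cases p) (auto split: if_splits)
    moreover have "2 # p \<in> set (nbrs (1 # p))"
      using in_nbrs(1)[of "1 # p"] kids_simps(2)[OF False na] by (simp add: numeral_2_eq_2)
    moreover have "0 # right_of p \<in> set (nbrs (2 # p))"
      using c by (simp add: kids_simps False na)
    ultimately show ?thesis
      using qr[unfolded nbrs_simps(3)[OF False na] cyclic_pairs_7] a b d e by auto
  qed
qed

lemma length_nbrs_le: "q \<in> set (nbrs p) \<Longrightarrow> length q \<le> Suc (length p)"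
  by (cases "p = []"; cases "apex p") (auto simp: nbrs_simps)

lemma nbrs_same_length:
  assumes "valid p" "q \<in> set (nbrs p)" "length q = length p"
  shows "p \<noteq> []" "q = right_of p \<or> p = right_of q"
proof -
  show ne: "p \<noteq> []"
    using assms(2,3) by (auto simp: nbrs_simps)
  then have "length (tl p) \<noteq> length p"
    by (cases p) auto
  then have "q = right_of p \<or> q = left_of p"
    using ne assms(2,3) by (cases "apex p") (auto simp: nbrs_simps)
  then show "q = right_of p \<or> p = right_of q"
    using right_of_left_of[OF assms(1)] by auto
qed

section \<open>Counting the layers\<close>

definition layer :: "nat \<Rightarrow> nat list set" where
  "layer n = {p. valid p \<and> length p = n}"

lemma layer_Suc: "layer (Suc n) = (\<lambda>(x, d). d # x) ` (SIGMA x:layer n. {..<kids x})"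
  unfolding layer_def by (auto simp: length_Suc_conv image_iff)

lemma finite_layer: "finite (layer n)"
proof (induction n)
  case 0
  have "layer 0 = {[]}"
    unfolding layer_def by auto
  then show ?case
    by simp
qed (simp add: layer_Suc)

lemma card_layer_Suc: "card (layer (Suc n)) = (\<Sum>x\<in>layer n. kids x)"
proof -
  have "inj_on (\<lambda>(x, d). d # x) (SIGMA x:layer n. {..<kids x})"
    by (auto simp: inj_on_def)
  then show ?thesis
    unfolding layer_Suc by (simp add: card_image card_SigmaI finite_layer)
qed

text \<open>Away from the centre \<open>kids\<close> is 3, and one less at an apex; adding the
  apices evens this out.\<close>

lemma card_layer_add_apex:
  "card (layer (Suc (Suc n))) + card {x \<in> layer (Suc n). apex x} = 3 * card (layer (Suc n))"
proof -
  have "card {x \<in> layer (Suc n). apex x} = (\<Sum>x\<in>layer (Suc n). if apex x then 1 else 0)"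
    using finite_layer by (simp add: sum.If_cases Int_def)
  then have "card (layer (Suc (Suc n))) + card {x \<in> layer (Suc n). apex x} =
      (\<Sum>x\<in>layer (Suc n). kids x + (if apex x then 1 else 0))"
    unfolding card_layer_Suc[of "Suc n"] sum.distrib by simp
  also have "\<dots> = (\<Sum>x\<in>layer (Suc n). 3)"
    by (rule sum.cong) (auto simp: layer_def kids_def)
  finally show ?thesis
    by simp
qed

text \<open>One apex \<open>0 # x\<close> stands on each edge of the layer below, the edge from
  \<open>left_of x\<close> to \<open>x\<close>.\<close>

lemma card_apex_layer: "card {x \<in> layer (Suc (Suc n)). apex x} = card (layer (Suc n))"
proof -
  have "0 < kids x" for x
    using kids_ge_2[of x] by simp
  then have "{x \<in> layer (Suc (Suc n)). apex x} = (#) 0 ` layer (Suc n)"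
    unfolding layer_def by (auto simp: length_Suc_conv)
  then show ?thesis
    by (simp add: card_image)
qed

text \<open>The number of apices serves as the previous term of the recurrence. Layer one has seven
  vertices and no apex, matching \<open>fib 2 = 1\<close> and \<open>fib 0 = 0\<close>; the step is
  \<open>fib (m + 4) + fib m = 3 * fib (m + 2)\<close>.\<close>

lemma card_layer:
  "card (layer (Suc n)) = 7 * fib (2 * Suc n) \<and> card {x \<in> layer (Suc n). apex x} = 7 * fib (2 * n)"
proof (induction n)
  case 0
  have "layer 0 = {[]}" and apex: "{x \<in> layer (Suc 0). apex x} = {}"
    unfolding layer_def by (auto simp: length_Suc_conv)
  then show ?case
    unfolding apex by (simp add: card_layer_Suc)
next
  case (Suc n)
  then show ?case
    using card_layer_add_apex[of n] card_apex_layer[of n] by simp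
qed

section \<open>The developing map is an isomorphism\<close>

lemma cyclic_pairs_map: "cyclic_pairs (map f xs) = map_prod f f ` cyclic_pairs xs"
  unfolding cyclic_pairs_def by (simp add: rotate1_map zip_map_map flip: set_map map_prod_def)

context development
begin

lemma develop_nbrs_inj: "valid p \<Longrightarrow> q \<in> set (nbrs p) \<Longrightarrow> q' \<in> set (nbrs p) \<Longrightarrow> develop q = develop q' \<Longrightarrow> q = q'"
  using develop_wheel[of p] unfolding wheel_def distinct_map by (auto dest: inj_onD)

lemma develop_nbr_neq: "valid p \<Longrightarrow> q \<in> set (nbrs p) \<Longrightarrow> develop q \<noteq> develop p"
  using develop_wheel[of p] unfolding wheel_def by (metis imageI list.set_map)

lemma develop_edge: "valid p \<Longrightarrow> q \<in> set (nbrs p) \<Longrightarrow> {develop p, develop q} \<in> K"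
  using develop_wheel[of p] develop_nbr_neq[of p q] unfolding wheel_def by (auto simp del: develop.simps)

lemma edge_lift:
  assumes "valid p" "{develop p, w} \<in> K" "w \<noteq> develop p"
  obtains q where "q \<in> set (nbrs p)" "w = develop q"
  using develop_wheel[of p] assms unfolding wheel_def by (auto simp del: develop.simps)

lemma tri_lift:
  assumes "valid p" "tri K (develop p) a b"
  obtains q r where "q \<in> set (nbrs p)" "r \<in> set (nbrs p)" "r \<in> set (nbrs q)" "a = develop q" "b = develop r"
proof -
  obtain q r where qr: "(q, r) \<in> cyclic_pairs (nbrs p) \<or> (r, q) \<in> cyclic_pairs (nbrs p)" "a = develop q" "b = develop r"
    using develop_wheel[OF assms(1)] assms(2) unfolding wheel_def cyclic_pairs_map by blast
  have sub: "cyclic_pairs (nbrs p) \<subseteq> set (nbrs p) \<times> set (nbrs p)"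
    unfolding cyclic_pairs_def by (auto dest: set_zip_leftD set_zip_rightD)
  have "r \<in> set (nbrs q)"
    using qr(1) nbrs_consecutive[OF assms(1)] nbrs_sym valid_nbrs[OF assms(1)] sub by blast
  then show thesis
    using that qr sub by blast
qed

definition lift :: "nat list \<Rightarrow> 'v \<Rightarrow> nat list" where
  "lift p w = (if w = develop p then p else THE q. q \<in> set (nbrs p) \<and> develop q = w)"

lemma lift_nbr:
  assumes "valid p" "q \<in> set (nbrs p)"
  shows "lift p (develop q) = q"
  unfolding lift_def using assms develop_nbr_neq[OF assms] develop_nbrs_inj[OF assms(1)] by (auto intro!: the_equality simp del: develop.simps)

lemma lift_self: "lift p (develop p) = p"
  unfolding lift_def by simp

sublocale covering: simplicial_covering K "Collect valid" develop lift
proof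
  show "abstract_complex K"
    by (rule complex)
  show "lift p w \<in> Collect valid" if "p \<in> Collect valid" "{develop p, w} \<in> K" for p w
    using that valid_nbrs[of p] lift_nbr[of p] lift_self[of p] by (metis edge_lift mem_Collect_eq)
  show "develop (lift p w) = w" if "p \<in> Collect valid" "{develop p, w} \<in> K" for p w
    using that lift_nbr[of p] lift_self[of p] by (metis edge_lift mem_Collect_eq)
  show "lift p (develop p) = p" for p
    by (rule lift_self)
  show "lift (lift p w) u = lift p u" if "p \<in> Collect valid" "{develop p, w, u} \<in> K" for p w u
  proof -
    have p: "valid p"
      using that by simp
    have "{develop p, w} \<in> K"
      using abstract_complex_face[OF complex that(2), of "{develop p, w}"] by auto
    consider "w = develop p" | "w \<noteq> develop p" "u = w" | "w \<noteq> develop p" "u = develop p" | "w \<noteq> develop p" "u \<noteq> w" "u \<noteq> develop p"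
      by blast
    then show ?thesis
    proof cases
      case 1
      then show ?thesis
        by (simp add: lift_self del: develop.simps)
    next
      case 2
      then obtain q where q: "q \<in> set (nbrs p)" "w = develop q"
        using edge_lift[OF p \<open>{develop p, w} \<in> K\<close>] by blast
      then show ?thesis
        using lift_nbr[OF p] lift_self 2 by simp
    next
      case 3
      then obtain q where q: "q \<in> set (nbrs p)" "w = develop q"
        using edge_lift[OF p \<open>{develop p, w} \<in> K\<close>] by blast
      then show ?thesis
        using lift_nbr[OF p q(1)] lift_nbr[OF valid_nbrs[OF p q(1)] nbrs_sym[OF p q(1)]] lift_self 3 by simp
    next
      \<comment> \<open>A nondegenerate triangle. Its lifted vertices \<open>q\<close> and
        \<open>r\<close> are adjacent in the model, so lifting \<open>u\<close> from
        \<open>p\<close> or from \<open>q\<close> gives the same \<open>r\<close>.\<close>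
      case 4
      then have "tri K (develop p) w u"
        using that(2) unfolding tri_def triangles_def by (simp add: card_insert_if)
      then obtain q r where q: "q \<in> set (nbrs p)" "r \<in> set (nbrs p)" "r \<in> set (nbrs q)" "w = develop q" "u = develop r"
        using tri_lift[OF p] by blast
      then show ?thesis
        using lift_nbr[OF p] lift_nbr[OF valid_nbrs[OF p q(1)]] by simp
    qed
  qed
qed

lemma simply_connected: "simply_connected (geometric_realization K)"
  using X7 unfolding X7_def by simp

lemma reach_root: "valid p \<Longrightarrow> (\<lambda>x y. valid x \<and> y \<in> set (nbrs x))\<^sup>*\<^sup>* p []"
proof (induction p)
  case (Cons d x)
  then have "x \<in> set (nbrs (d # x))"
    using in_nbrs(3)[of "d # x"] by simp
  then show ?case
    using Cons by (intro converse_rtranclp_into_rtranclp[of _ "d # x" x]) auto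
qed simp

text \<open>Vertices with equal image are joined by a walk through the root; its image is a closed
  loop in \<open>K\<close> and the walk is the lift of that loop, so its ends agree.\<close>

lemma develop_inj: "inj_on develop (Collect valid)"
proof (rule inj_onI)
  fix p q assume pq: "p \<in> Collect valid" "q \<in> Collect valid" "develop p = develop q"
  let ?R = "\<lambda>x y. valid x \<and> y \<in> set (nbrs x)"
  have "symp ?R"
    using nbrs_sym valid_nbrs by (blast intro: sympI)
  then have "?R\<^sup>*\<^sup>* [] q"
    using reach_root[of q] pq(2) by (auto dest: sympD[OF symp_rtranclp])
  then have "?R\<^sup>*\<^sup>* p q"
    using reach_root[of p] pq(1) by (auto intro: rtranclp_trans)
  then have "\<exists>n. (?R ^^ n) p q"
    by (rule rtranclp_imp_relpowp)
  then obtain n where "(?R ^^ n) p q"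
    by (elim exE)
  then have "\<exists>f. f 0 = p \<and> f n = q \<and> (\<forall>i<n. ?R (f i) (f (Suc i)))"
    by (simp only: relpowp_fun_conv)
  then obtain f where f0: "f 0 = p" and fn: "f n = q" and f: "\<forall>i<n. ?R (f i) (f (Suc i))"
    by (elim exE conjE)
  have "f n = f 0"
  proof (rule covering.lifted_loop_closes[OF simply_connected])
    show "f 0 \<in> Collect valid" "develop (f n) = develop (f 0)"
      using pq unfolding f0 fn by simp_all
    show "{develop (f i), develop (f (Suc i))} \<in> K" "f (Suc i) = lift (f i) (develop (f (Suc i)))" if "i < n" for i
      using f that develop_edge[of "f i"] lift_nbr[of "f i"] by simp_all
  qed
  then show "p = q"
    using f0 fn by simp
qed

lemma develop_surj:
  assumes "v \<in> vertices K" "w \<in> vertices K"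
  obtains p where "valid p" "w = develop p"
proof -
  have "w \<in> develop ` Collect valid"
  proof (rule simply_connected_adjacency_closed[OF complex simply_connected _ assms(1) _ assms(2)])
    show "v \<in> develop ` Collect valid"
      by (rule image_eqI[of _ _ "[]"]) auto
    show "y \<in> develop ` Collect valid" if xy: "x \<in> develop ` Collect valid" "{x, y} \<in> K" for x y
    proof -
      obtain p where "p \<in> Collect valid" "x = develop p"
        using xy(1) by blast
      then show ?thesis
        using xy(2) covering.lift_in[of p y] covering.lift_over[of p y]
        by (intro image_eqI[of _ _ "lift p y"]) simp_all
    qed
  qed
  then show thesis
    using that by blast
qed

lemma develop_eq_iff: "valid p \<Longrightarrow> valid q \<Longrightarrow> develop p = develop q \<longleftrightarrow> p = q"
  using develop_inj by (auto dest: inj_onD)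

lemma edge_thirds:
  assumes "tri K x y c"
  shows "\<exists>a b. a \<noteq> b \<and> (\<forall>z. tri K x y z \<longleftrightarrow> z = a \<or> z = b)"
proof -
  obtain x2 x3 x4 x5 x6 where w: "wheel K x [c, y, x2, x3, x4, x5, x6]"
    using tri_wheel[OF tri_swap(2)[OF assms]] by blast
  show ?thesis
    by (rule exI[of _ c], rule exI[of _ x2]) (use w in \<open>auto simp: wheel_def cyclic_pairs_7\<close>)
qed

text \<open>Reduces the boundary condition to an exclusive or over the two triangles of
  \<open>K\<close> at the edge; \<open>P\<close> will say that a triangle meets a ball.\<close>

lemma card_edge_triangles_eq_1:
  assumes ab: "a \<noteq> b" "\<And>z. tri K x y z \<longleftrightarrow> z = a \<or> z = b"
  shows "card {t \<in> triangles K. {x, y} \<subseteq> t \<and> P t} = 1 \<longleftrightarrow> P {x, y, a} \<noteq> P {x, y, b}"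
proof -
  have neq: "x \<noteq> y" "a \<notin> {x, y}" "b \<notin> {x, y}"
    using ab tri_distinct[of K x y a] tri_distinct[of K x y b] by auto
  have "t \<in> triangles K \<and> {x, y} \<subseteq> t \<longleftrightarrow> t = {x, y, a} \<or> t = {x, y, b}" for t
  proof
    assume t: "t \<in> triangles K \<and> {x, y} \<subseteq> t"
    then have "card (t - {x, y}) = 1"
      using neq(1) unfolding triangles_def by (subst card_Diff_subset) auto
    then obtain z where "t - {x, y} = {z}"
      by (rule card_1_singletonE)
    then have tz: "t = {x, y, z}"
      using t by blast
    then have "tri K x y z"
      using t unfolding tri_def by simp
    then show "t = {x, y, a} \<or> t = {x, y, b}"
      using ab(2)[of z] tz by auto
  qed (use ab(2) in \<open>auto simp: tri_def\<close>)
  then have "{t \<in> triangles K. {x, y} \<subseteq> t \<and> P t} = {t. (t = {x, y, a} \<or> t = {x, y, b}) \<and> P t}"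
    by blast
  also have "\<dots> = (if P {x, y, a} then {{x, y, a}} else {}) \<union> (if P {x, y, b} then {{x, y, b}} else {})"
    by auto
  finally have eq: "{t \<in> triangles K. {x, y} \<subseteq> t \<and> P t} = \<dots>" .
  have "{x, y, a} \<noteq> {x, y, b}"
    using neq ab(1) by blast
  then show ?thesis
    unfolding eq by simp
qed

section \<open>Boundary edges of the disks\<close>

definition ball_vertices :: "nat \<Rightarrow> 'v set" where
  "ball_vertices r = develop ` {p. valid p \<and> length p \<le> r}"

lemma develop_in_ball: "valid p \<Longrightarrow> develop p \<in> ball_vertices r \<longleftrightarrow> length p \<le> r"
  unfolding ball_vertices_def using develop_eq_iff by blast

lemma down_triangle:
  assumes "valid p" "p \<noteq> []"
  shows "tri K (develop p) (develop (right_of p)) (develop (tl p))"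
  using pregood[OF assms] unfolding pregood_def by (simp add: tri_comm)

lemma up_triangle:
  assumes "valid p" "p \<noteq> []"
  shows "tri K (develop p) (develop (right_of p)) (develop (0 # right_of p))"
  using develop_wheel[OF assms(1)] assms(2) unfolding nbrs_def
  by (cases "apex p") (auto dest!: wheel_7 simp: tri_comm simp del: develop.simps)

end

section \<open>Disks around the centre\<close>

locale centred_development = development K v hub for K :: "'v set set" and v :: 'v and hub :: "'v list" +
  assumes centre: "v \<in> vertices K"
begin

lemma vertex_develop:
  assumes "w \<in> vertices K"
  obtains p where "valid p" "w = develop p"
  using develop_surj[OF centre assms] by blast

text \<open>A step to a neighbour raises the length by at most one, and conversely each new vertex
  \<open>p\<close> lies in a triangle with \<open>tl p\<close>, which is already in the
  ball.\<close>

lemma vertices_comb_disk: "vertices (comb_disk K v r) = ball_vertices r"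
proof (induction r)
  case 0
  have "{p. valid p \<and> length p \<le> 0} = {[]}"
    by auto
  then show ?case
    unfolding ball_vertices_def vertices_def by simp
next
  case (Suc r)
  have "\<Union>{s. s \<noteq> {} \<and> (\<exists>t\<in>T. t \<inter> B \<noteq> {} \<and> s \<subseteq> t)} = \<Union>{t \<in> T. t \<inter> B \<noteq> {}}" for T and B :: "'v set"
    by blast
  then have "vertices (comb_disk K v (Suc r)) =
      ball_vertices r \<union> \<Union>{t \<in> triangles K. t \<inter> ball_vertices r \<noteq> {}}"
    unfolding comb_disk.simps Suc vertices_def Union_Un_distrib using Suc[unfolded vertices_def] by simp
  also have "\<dots> = ball_vertices (Suc r)"
  proof (intro equalityI subsetI)
    fix w assume "w \<in> ball_vertices r \<union> \<Union>{t \<in> triangles K. t \<inter> ball_vertices r \<noteq> {}}"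
    then consider "w \<in> ball_vertices r" | t p where "t \<in> triangles K" "w \<in> t" "develop p \<in> t" "valid p" "length p \<le> r"
      unfolding ball_vertices_def by blast
    then show "w \<in> ball_vertices (Suc r)"
    proof cases
      case 1
      then show ?thesis
        unfolding ball_vertices_def by auto
    next
      case 2
      show ?thesis
      proof (cases "w = develop p")
        case True
        then show ?thesis
          using 2 by (simp add: develop_in_ball del: develop.simps)
      next
        case False
        have "{develop p, w} \<in> K"
          using 2 abstract_complex_face[OF complex, of t "{develop p, w}"] unfolding triangles_def by auto
        then obtain q where q: "q \<in> set (nbrs p)" "w = develop q"
          using edge_lift[OF 2(4) _ False] by blast
        then show ?thesis
          using length_nbrs_le[OF q(1)] valid_nbrs[OF 2(4) q(1)] 2(5) by (simp add: develop_in_ball del: develop.simps)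
      qed
    qed
  next
    fix w assume "w \<in> ball_vertices (Suc r)"
    then obtain p where p: "w = develop p" "valid p" "length p \<le> Suc r"
      unfolding ball_vertices_def by blast
    show "w \<in> ball_vertices r \<union> \<Union>{t \<in> triangles K. t \<inter> ball_vertices r \<noteq> {}}"
    proof (cases "length p \<le> r")
      case True
      then show ?thesis
        using p by (simp add: develop_in_ball del: develop.simps)
    next
      case False
      then have ne: "p \<noteq> []"
        by auto
      have "{develop p, develop (right_of p), develop (tl p)} \<in> triangles K"
        using down_triangle[OF p(2) ne] unfolding tri_def .
      moreover have "develop (tl p) \<in> ball_vertices r"
        using p by (simp add: develop_in_ball valid_tl del: develop.simps)
      ultimately show ?thesis
        using p(1) by blast
    qed
  qed
  finally show ?case .
qed

text \<open>A face with three vertices is the whole triangle, and triangles added at earlier stages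
  meet a smaller ball.\<close>

lemma triangles_comb_disk:
  "triangles (comb_disk K v (Suc r)) = {t \<in> triangles K. t \<inter> ball_vertices r \<noteq> {}}"
proof -
  have new: "triangles {s. s \<noteq> {} \<and> (\<exists>t\<in>triangles K. t \<inter> B \<noteq> {} \<and> s \<subseteq> t)} =
      {t \<in> triangles K. t \<inter> B \<noteq> {}}" for B
  proof (intro equalityI subsetI)
    fix s assume "s \<in> triangles {s. s \<noteq> {} \<and> (\<exists>t\<in>triangles K. t \<inter> B \<noteq> {} \<and> s \<subseteq> t)}"
    then obtain t where t: "t \<in> triangles K" "t \<inter> B \<noteq> {}" "s \<subseteq> t" "card s = 3"
      unfolding triangles_def by blast
    have "card t = 3"
      using t(1) unfolding triangles_def by simp
    then have "s = t"
      using t(3,4) by (intro card_subset_eq) (auto intro: card_ge_0_finite)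
    then show "s \<in> {t \<in> triangles K. t \<inter> B \<noteq> {}}"
      using t by simp
  qed (auto simp: triangles_def)
  have un: "triangles (A \<union> B) = triangles A \<union> triangles B" for A B :: "'v set set"
    unfolding triangles_def by blast
  have step: "triangles (comb_disk K v (Suc r)) =
      triangles (comb_disk K v r) \<union> {t \<in> triangles K. t \<inter> ball_vertices r \<noteq> {}}" for r
    unfolding comb_disk.simps un vertices_comb_disk new ..
  have "triangles (comb_disk K v r) \<subseteq> {t \<in> triangles K. t \<inter> ball_vertices r \<noteq> {}}"
  proof (induction r)
    case 0
    then show ?case
      unfolding triangles_def by auto
  next
    case (Suc r)
    have "ball_vertices r \<subseteq> ball_vertices (Suc r)"
      unfolding ball_vertices_def by auto
    then show ?case
      using Suc unfolding step by blast
  qed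
  then show ?thesis
    unfolding step by blast
qed

lemma ball_triple:
  assumes "valid p" "valid q" "valid c"
  shows "{develop p, develop q, develop c} \<inter> ball_vertices r \<noteq> {} \<longleftrightarrow> length p \<le> r \<or> length q \<le> r \<or> length c \<le> r"
  using assms develop_in_ball by auto

lemma in_boundary_iff:
  assumes "e \<in> edges K"
  shows "e \<in> boundary_edges K (comb_disk K v (Suc r)) \<longleftrightarrow>
    card {t \<in> triangles K. e \<subseteq> t \<and> t \<inter> ball_vertices r \<noteq> {}} = 1"
proof -
  have "{t \<in> triangles (comb_disk K v (Suc r)). e \<subseteq> t} =
      {t \<in> triangles K. e \<subseteq> t \<and> t \<inter> ball_vertices r \<noteq> {}}"
    unfolding triangles_comb_disk by blast
  then show ?thesis
    using assms unfolding boundary_edges_def by simp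
qed

lemma nbr_in_triangle:
  assumes "valid p" "q \<in> set (nbrs p)"
  obtains c where "tri K (develop p) (develop q) c"
proof -
  obtain x0 x1 x2 x3 x4 x5 x6 where "map develop (nbrs p) = [x0, x1, x2, x3, x4, x5, x6]"
    using develop_wheel[OF assms(1)] unfolding wheel_def by (elim conjE length_7_cases)
  then have "wheel K (develop p) [x0, x1, x2, x3, x4, x5, x6]" "develop q \<in> {x0, x1, x2, x3, x4, x5, x6}"
    using develop_wheel[OF assms(1)] assms(2) by (auto simp flip: set_map simp del: develop.simps)
  then show thesis
    using that wheel_7[of K "develop p"] tri_swap by blast
qed

text \<open>An edge between consecutive layers is interior to the disk or misses it altogether, since both its
  triangles have a vertex in the lower layer and none below.\<close>

lemma vertical_edge_not_boundary:
  assumes p: "valid p" and q: "q \<in> set (nbrs p)" and len: "length q = Suc (length p)"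
  shows "card {t \<in> triangles K. {develop p, develop q} \<subseteq> t \<and> t \<inter> ball_vertices r \<noteq> {}} \<noteq> 1"
proof -
  have vq: "valid q"
    using valid_nbrs[OF p q] .
  obtain c where "tri K (develop p) (develop q) c"
    using nbr_in_triangle[OF p q] .
  then obtain a b where ab: "a \<noteq> b" "\<And>z. tri K (develop p) (develop q) z \<longleftrightarrow> z = a \<or> z = b"
    using edge_thirds[of "develop p" "develop q" c] by auto
  have "{develop p, develop q, z} \<inter> ball_vertices r \<noteq> {} \<longleftrightarrow> length p \<le> r" if z: "z = a \<or> z = b" for z
  proof -
    have "tri K (develop q) (develop p) z"
      using ab(2)[of z] z by (subst tri_comm(1)) simp
    then obtain c where c: "c \<in> set (nbrs q)" "z = develop c"
      by (rule tri_lift[OF vq]) blast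
    have vc: "valid c"
      using valid_nbrs[OF vq c(1)] .
    show ?thesis
      using length_nbrs_le[OF nbrs_sym[OF vq c(1)]] len unfolding c(2) ball_triple[OF p vq vc] by auto
  qed
  then have "({develop p, develop q, a} \<inter> ball_vertices r \<noteq> {}) = ({develop p, develop q, b} \<inter> ball_vertices r \<noteq> {})"
    by simp
  then show ?thesis
    unfolding card_edge_triangles_eq_1[OF ab, where P = "\<lambda>t. t \<inter> ball_vertices r \<noteq> {}"] by simp
qed

text \<open>The third vertices at the edge are \<open>tl p\<close>, one layer in, and
  \<open>0 # right_of p\<close>, one layer out. The inner triangle meets the ball iff
  \<open>length p \<le> Suc r\<close>, the outer one iff \<open>length p \<le> r\<close>.\<close>

lemma horizontal_edge_boundary:
  assumes p: "valid p" "p \<noteq> []"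
  shows "card {t \<in> triangles K. {develop p, develop (right_of p)} \<subseteq> t \<and> t \<inter> ball_vertices r \<noteq> {}} = 1 \<longleftrightarrow> length p = Suc r"
proof -
  have nk: "valid (right_of p)" "valid (tl p)" "valid (0 # right_of p)"
    using p kids_ge_2[of "right_of p"] by (auto simp: valid_right_of valid_tl)
  obtain a b where ab: "a \<noteq> b" "\<And>z. tri K (develop p) (develop (right_of p)) z \<longleftrightarrow> z = a \<or> z = b"
    using edge_thirds[OF down_triangle[OF p]] by auto
  have "develop (tl p) \<noteq> develop (0 # right_of p)"
  proof
    assume "develop (tl p) = develop (0 # right_of p)"
    then have "tl p = 0 # right_of p"
      using develop_eq_iff nk by blast
    then have "length (tl p) = length (0 # right_of p)"
      by simp
    then show False
      by simp
  qed
  then have ab': "{a, b} = {develop (tl p), develop (0 # right_of p)}"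
    using down_triangle[OF p] up_triangle[OF p] unfolding ab(2) by auto
  have "({develop p, develop (right_of p), develop (tl p)} \<inter> ball_vertices r \<noteq> {}) \<noteq>
      ({develop p, develop (right_of p), develop (0 # right_of p)} \<inter> ball_vertices r \<noteq> {}) \<longleftrightarrow> length p = Suc r"
    using p(2) unfolding ball_triple[OF p(1) nk(1,2)] ball_triple[OF p(1) nk(1,3)] by (cases p) auto
  then show ?thesis
    unfolding card_edge_triangles_eq_1[OF ab, where P = "\<lambda>t. t \<inter> ball_vertices r \<noteq> {}"]
    using ab' by (auto simp: doubleton_eq_iff simp del: develop.simps)
qed

lemma nbr_edge:
  assumes "valid p" "q \<in> set (nbrs p)"
  shows "{develop p, develop q} \<in> edges K"
  using develop_edge[OF assms] develop_nbr_neq[OF assms] unfolding edges_def by (simp add: card_insert_if)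

lemma boundary_comb_disk:
  "boundary_edges K (comb_disk K v (Suc r)) = (\<lambda>p. {develop p, develop (right_of p)}) ` layer (Suc r)"
proof (intro equalityI subsetI)
  fix e assume e: "e \<in> boundary_edges K (comb_disk K v (Suc r))"
  then have eE: "e \<in> edges K"
    unfolding boundary_edges_def by simp
  then obtain x y where xy: "e = {x, y}" "x \<noteq> y" "{x, y} \<in> K"
    unfolding edges_def by (auto simp: card_2_iff)
  have "x \<in> vertices K"
    using xy(3) unfolding vertices_def by blast
  then obtain p where p: "valid p" "x = develop p"
    by (rule vertex_develop)
  obtain q where q: "q \<in> set (nbrs p)" "y = develop q"
    using edge_lift[OF p(1)] xy(2,3) p(2) by metis
  have vq: "valid q"
    using valid_nbrs[OF p(1) q(1)] .
  have c: "card {t \<in> triangles K. {develop p, develop q} \<subseteq> t \<and> t \<inter> ball_vertices r \<noteq> {}} = 1"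
    using e in_boundary_iff[OF eE] unfolding xy(1) p(2) q(2) by simp
  have swap: "{develop q, develop p} = {develop p, develop q}"
    by (rule insert_commute)
  have "length q \<noteq> Suc (length p)"
    using vertical_edge_not_boundary[OF p(1) q(1)] c by blast
  moreover have "length p \<noteq> Suc (length q)"
    using vertical_edge_not_boundary[OF vq nbrs_sym[OF p(1) q(1)], unfolded swap] c by blast
  ultimately have len: "length q = length p"
    using length_nbrs_le[OF q(1)] length_nbrs_le[OF nbrs_sym[OF p(1) q(1)]] by linarith
  have ne: "p \<noteq> []" "q \<noteq> []"
    using nbrs_same_length(1)[OF p(1) q(1) len] len by auto
  have "\<exists>z. valid z \<and> z \<noteq> [] \<and> e = {develop z, develop (right_of z)}"
    using nbrs_same_length(2)[OF p(1) q(1) len]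
  proof
    assume "q = right_of p"
    then show ?thesis
      using p ne(1) xy(1) q(2) by blast
  next
    assume "p = right_of q"
    then show ?thesis
      using vq ne(2) xy(1) p(2) q(2) swap by blast
  qed
  then obtain z where z: "valid z" "z \<noteq> []" "e = {develop z, develop (right_of z)}"
    by blast
  have "length z = Suc r"
    using e in_boundary_iff[OF eE] horizontal_edge_boundary[OF z(1,2)] unfolding z(3) by simp
  then show "e \<in> (\<lambda>p. {develop p, develop (right_of p)}) ` layer (Suc r)"
    using z unfolding layer_def by blast
next
  fix e assume "e \<in> (\<lambda>p. {develop p, develop (right_of p)}) ` layer (Suc r)"
  then obtain p where p: "valid p" "length p = Suc r" "e = {develop p, develop (right_of p)}"
    unfolding layer_def by blast
  then have ne: "p \<noteq> []"
    by auto
  have "e \<in> edges K"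
    unfolding p(3) by (rule nbr_edge[OF p(1) in_nbrs(1)[OF ne]])
  then show "e \<in> boundary_edges K (comb_disk K v (Suc r))"
    using in_boundary_iff horizontal_edge_boundary[OF p(1) ne] p(2,3) by simp
qed

text \<open>An edge named twice would give a vertex with equal left and right neighbours, but these
  are distinct entries of its wheel.\<close>

lemma inj_on_layer_edges: "inj_on (\<lambda>p. {develop p, develop (right_of p)}) (layer (Suc r))"
proof (rule inj_onI)
  fix p q assume "p \<in> layer (Suc r)" "q \<in> layer (Suc r)" and eq: "{develop p, develop (right_of p)} = {develop q, develop (right_of q)}"
  then have p: "valid p" "p \<noteq> []" and q: "valid q"
    unfolding layer_def by auto
  have "p = q \<or> p = right_of q \<and> right_of p = q"
    using eq p q valid_right_of by (simp add: doubleton_eq_iff develop_eq_iff del: develop.simps) blast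
  moreover have "right_of p \<noteq> left_of p"
    using develop_wheel[OF p(1)] p(2) unfolding wheel_def nbrs_def by (auto split: if_splits)
  ultimately show "p = q"
    using left_of_right_of[OF q] by auto
qed

lemma perimeter_Suc: "perimeter K v (Suc r) = 7 * fib (2 * Suc r)"
  unfolding perimeter_def boundary_comb_disk card_image[OF inj_on_layer_edges] using card_layer by blast

end

theorem theorem1:
  fixes K :: "'v set set" and v :: 'v and r :: nat
  assumes "X7 K" and "v \<in> vertices K" and "1 \<le> r"
  shows "perimeter K v r = 7 * fib (2 * r)"
proof -
  obtain hub where "wheel K v hub"
    using wheel_exists[OF assms(1,2)] by blast
  then interpret centred_development K v hub
    using assms by unfold_locales
  show ?thesis
    using perimeter_Suc[of "r - 1"] assms(3) by simp
qed

end
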